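(* For all integers $m,n\geq 0$, the bubble poset $\mathbf{Bub}(m,n)$ is a lattice. Moreover, $\mathbf{Bub}(m,n)$ is extremal, semidistributive and constructable by interval doublings.
   Context: Fix integers $m,n\geq 0$ and disjoint alphabets $X=\{x_1,\dots,x_m\}$, $Y=\{y_1,\dots,y_n\}$; write $\mathbf{x}=x_1x_2\cdots x_m$ and $\mathbf{y}=y_1y_2\cdots y_n$. A word over $X\cup Y$ is simple if it has no repeated letter; set-theoretic notation applied to a word refers to its set of letters. A subword of $w_1\cdots w_k$ is a word $w_{i_1}\cdots w_{i_l}$ with $i_1<\dots<i_l$. For simple words $\mathbf{u},\mathbf{v}$, the restriction $\mathbf{u}_{\mathbf{v}}$ is the subword of $\mathbf{u}$ formed by the letters occurring in both $\mathbf{u}$ and $\mathbf{v}$. A shuffle word is a simple word $\mathbf{u}$ over $X\cup Y$ such that $\mathbf{u}_{\mathbf{x}}$ is a subword of $\mathbf{x}$ and $\mathbf{u}_{\mathbf{y}}$ is a subword of $\mathbf{y}$ (the empty word is allowed); $\mathsf{Shuf}(m,n)$ is the set of shuffle words. For $\mathbf{u}=u_1\cdots u_k$ and $i\in[k]$, $\mathbf{u}_{\hat\imath}$ denotes $\mathbf{u}$ with the letter $u_i$ deleted. An indel is a relation $\mathbf{u}\to\mathbf{u}_{\hat\imath}$ if $u_i\in X$, or $\mathbf{u}_{\hat\imath}\to\mathbf{u}$ if $u_i\in Y$. A transposition is a relation $\mathbf{u}\Rightarrow\mathbf{u}'$ where $u_i\in X$, $u_{i+1}\in Y$ and $\mathbf{u}'$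 is obtained from $\mathbf{u}$ by swapping $u_i$ and $u_{i+1}$. The bubble order $\leq_{\mathsf{bub}}$ on $\mathsf{Shuf}(m,n)$ is the reflexive and transitive closure of indels and transpositions, and $\mathbf{Bub}(m,n)=(\mathsf{Shuf}(m,n),\leq_{\mathsf{bub}})$. A finite lattice of length $k$ (length = maximal number of covering steps in a chain) is extremal if it has exactly $k$ join-irreducible and exactly $k$ meet-irreducible elements. A lattice is join semidistributive if $p\vee q=p\vee r$ implies $p\vee q=p\vee(q\wedge r)$ for all $p,q,r$; meet semidistributive if the dual holds; semidistributive if both. For a poset $\mathbf{P}$ and a subset $S\subseteq P$, let $P_{\leq S}=\{p: p\leq s\text{ for some }s\in S\}$; the doubling $\mathbf{P}[S]$ is the induced subposet of $\mathbf{P}\times\mathbf{2}$ (with $\mathbf{2}$ the chain $1<2$) on the set $(P_{\leq S}\times\{1\})\uplus(((P\setminus P_{\leq S})\cup S)\times\{2\})$. A finite lattice is constructable by interval doublings if it is isomorphic to a lattice obtained from the one-element lattice by a finite sequence of doublings by intervals. *)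

theory Defs
  imports "HOL-Library.Sublist" "HOL-Algebra.Lattice"
begin

section \<open>Shuffle words and the bubble order\<close>

datatype letter = LX nat | LY nat

type_synonym word = "letter list"

definition xword :: "nat \<Rightarrow> word" where
  "xword m = map LX [1..<Suc m]"

definition yword :: "nat \<Rightarrow> word" where
  "yword n = map LY [1..<Suc n]"

definition restriction :: "word \<Rightarrow> word \<Rightarrow> word" where
  "restriction u v = filter (\<lambda>a. a \<in> set v) u"

definition Shuf :: "nat \<Rightarrow> nat \<Rightarrow> word set" where
  "Shuf m n = {u. distinct u \<and> set u \<subseteq> set (xword m) \<union> set (yword n) \<and>
     subseq (restriction u (xword m)) (xword m) \<and>
     subseq (restriction u (yword n)) (yword n)}"

text \<open>Positions in a word are counted from 0.\<close>

definition delete_at :: "nat \<Rightarrow> word \<Rightarrow> word" where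
  "delete_at i u = take i u @ drop (Suc i) u"

definition indel :: "nat \<Rightarrow> nat \<Rightarrow> word \<Rightarrow> word \<Rightarrow> bool" where
  "indel m n u v \<longleftrightarrow> u \<in> Shuf m n \<and> v \<in> Shuf m n \<and>
     ((\<exists>i < length u. u ! i \<in> set (xword m) \<and> v = delete_at i u) \<or>
      (\<exists>i < length v. v ! i \<in> set (yword n) \<and> u = delete_at i v))"

definition transposition :: "nat \<Rightarrow> nat \<Rightarrow> word \<Rightarrow> word \<Rightarrow> bool" where
  "transposition m n u v \<longleftrightarrow> u \<in> Shuf m n \<and> v \<in> Shuf m n \<and>
     (\<exists>i. Suc i < length u \<and> u ! i \<in> set (xword m) \<and> u ! Suc i \<in> set (yword n) \<and>
        v = u[i := u ! Suc i, Suc i := u ! i])"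

definition bubble_le :: "nat \<Rightarrow> nat \<Rightarrow> word \<Rightarrow> word \<Rightarrow> bool" where
  "bubble_le m n = (\<lambda>u v. indel m n u v \<or> transposition m n u v)\<^sup>*\<^sup>*"

definition Bub :: "nat \<Rightarrow> nat \<Rightarrow> word gorder" where
  "Bub m n = \<lparr>carrier = Shuf m n, eq = (=), le = bubble_le m n\<rparr>"

section \<open>Extremal lattices\<close>

definition covered_by :: "'a gorder \<Rightarrow> 'a \<Rightarrow> 'a \<Rightarrow> bool" where
  "covered_by L p q \<longleftrightarrow> p \<in> carrier L \<and> q \<in> carrier L \<and> p \<sqsubset>\<^bsub>L\<^esub> q \<and>
     \<not> (\<exists>r \<in> carrier L. p \<sqsubset>\<^bsub>L\<^esub> r \<and> r \<sqsubset>\<^bsub>L\<^esub> q)"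

text \<open>Only meaningful for a finite nonempty carrier, where the maximum exists.\<close>

definition poset_length :: "'a gorder \<Rightarrow> nat" where
  "poset_length L = Max {k. \<exists>c :: nat \<Rightarrow> 'a.
     (\<forall>i \<le> k. c i \<in> carrier L) \<and> (\<forall>i < k. covered_by L (c i) (c (Suc i)))}"

text \<open>The least (greatest) element is not counted as join (meet) irreducible.\<close>

definition join_irreducibles :: "'a gorder \<Rightarrow> 'a set" where
  "join_irreducibles L = {j \<in> carrier L. \<not> least L j (carrier L) \<and>
     (\<forall>p \<in> carrier L. \<forall>q \<in> carrier L. j = p \<squnion>\<^bsub>L\<^esub> q \<longrightarrow> j = p \<or> j = q)}"

definition meet_irreducibles :: "'a gorder \<Rightarrow> 'a set" where
  "meet_irreducibles L = {j \<in> carrier L. \<not> greatest L j (carrier L) \<and>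
     (\<forall>p \<in> carrier L. \<forall>q \<in> carrier L. j = p \<sqinter>\<^bsub>L\<^esub> q \<longrightarrow> j = p \<or> j = q)}"

definition extremal :: "'a gorder \<Rightarrow> bool" where
  "extremal L \<longleftrightarrow> lattice L \<and> finite (carrier L) \<and>
     card (join_irreducibles L) = poset_length L \<and>
     card (meet_irreducibles L) = poset_length L"

section \<open>Semidistributive lattices\<close>

definition join_semidistributive :: "'a gorder \<Rightarrow> bool" where
  "join_semidistributive L \<longleftrightarrow> lattice L \<and>
     (\<forall>p \<in> carrier L. \<forall>q \<in> carrier L. \<forall>r \<in> carrier L.
        p \<squnion>\<^bsub>L\<^esub> q = p \<squnion>\<^bsub>L\<^esub> r \<longrightarrow> p \<squnion>\<^bsub>L\<^esub> q = p \<squnion>\<^bsub>L\<^esub> (q \<sqinter>\<^bsub>L\<^esub> r))"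

definition meet_semidistributive :: "'a gorder \<Rightarrow> bool" where
  "meet_semidistributive L \<longleftrightarrow> lattice L \<and>
     (\<forall>p \<in> carrier L. \<forall>q \<in> carrier L. \<forall>r \<in> carrier L.
        p \<sqinter>\<^bsub>L\<^esub> q = p \<sqinter>\<^bsub>L\<^esub> r \<longrightarrow> p \<sqinter>\<^bsub>L\<^esub> q = p \<sqinter>\<^bsub>L\<^esub> (q \<squnion>\<^bsub>L\<^esub> r))"

definition semidistributive :: "'a gorder \<Rightarrow> bool" where
  "semidistributive L \<longleftrightarrow> join_semidistributive L \<and> meet_semidistributive L"

section \<open>Interval doublings\<close>

definition down_closure :: "'a gorder \<Rightarrow> 'a set \<Rightarrow> 'a set" where
  "down_closure P S = {p \<in> carrier P. \<exists>s \<in> S. p \<sqsubseteq>\<^bsub>P\<^esub> s}"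

definition doubling :: "'a gorder \<Rightarrow> 'a set \<Rightarrow> ('a \<times> nat) gorder" where
  "doubling P S = \<lparr>
     carrier = down_closure P S \<times> {1} \<union> ((carrier P - down_closure P S) \<union> S) \<times> {2},
     eq = (=),
     le = (\<lambda>(p, i) (q, j). p \<sqsubseteq>\<^bsub>P\<^esub> q \<and> i \<le> j)\<rparr>"

definition order_isomorphic :: "'a gorder \<Rightarrow> 'b gorder \<Rightarrow> bool" where
  "order_isomorphic P Q \<longleftrightarrow>
     (\<exists>f. order_emb P Q f \<and> bij_betw f (carrier P) (carrier Q))"

text \<open>
  Doubling changes the element type, so a sequence of doublings cannot be iterated inside one
  HOL type as it stands. After each step the result is therefore replaced by an arbitrary
  isomorphic copy on natural numbers; all orders involved are finite, so such copies always
  exist, and doubling respects isomorphism.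
\<close>

inductive obtained_by_interval_doublings :: "nat gorder \<Rightarrow> bool" where
  one_element:
    "partial_order P \<Longrightarrow> carrier P = {p} \<Longrightarrow> obtained_by_interval_doublings P"
| double:
    "obtained_by_interval_doublings P \<Longrightarrow> a \<in> carrier P \<Longrightarrow> b \<in> carrier P \<Longrightarrow> a \<sqsubseteq>\<^bsub>P\<^esub> b \<Longrightarrow>
     partial_order Q \<Longrightarrow> order_isomorphic (doubling P \<lbrace>a..b\<rbrace>\<^bsub>P\<^esub>) Q \<Longrightarrow>
     obtained_by_interval_doublings Q"

definition constructable_by_interval_doublings :: "'a gorder \<Rightarrow> bool" where
  "constructable_by_interval_doublings L \<longleftrightarrow> lattice L \<and> finite (carrier L) \<and>
     (\<exists>P. obtained_by_interval_doublings P \<and> order_isomorphic L P)"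

end

theory Submission
  imports Defs
begin

text \<open>
  A shuffle word \<open>u\<close> is encoded by the set \<open>B\<close> of indices of its \<open>y\<close>-letters together with, for
  every \<open>s\<close>, the largest index of a \<open>y\<close>-letter preceding \<open>x\<^sub>s\<close> (\<open>0\<close> if there is none, \<open>n + 1\<close> if
  \<open>x\<^sub>s\<close> is absent). The bubble order becomes the componentwise order on codes, so a maximal chain
  has length \<open>n + m (n + 1)\<close>, the sum of all entries of the top code. Codes with no \<open>x\<close>-entries
  form a Boolean lattice. Prepending an entry \<open>c\<close> for a new first \<open>x\<close>-letter is a sequence of
  \<open>n + 1\<close> interval doublings: one first decides whether \<open>c = n + 1\<close>, then whether \<open>c \<ge> n\<close>,
  \<open>c \<ge> n - 1\<close>, and so on down to \<open>c \<ge> 1\<close>. Each interval doubling preserves the lattice property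
  and semidistributivity and creates exactly one new join irreducible and one new meet
  irreducible, so there are \<open>n + m (n + 1)\<close> of each.
\<close>

section \<open>Lattices as partial orders\<close>

lemma (in partial_order) join_equality:
  assumes "x \<in> carrier L" "y \<in> carrier L" "z \<in> carrier L" "x \<sqsubseteq> z" "y \<sqsubseteq> z"
    and "\<And>w. w \<in> carrier L \<Longrightarrow> x \<sqsubseteq> w \<Longrightarrow> y \<sqsubseteq> w \<Longrightarrow> z \<sqsubseteq> w"
  shows "x \<squnion> y = z"
proof -
  have "least L z (Upper L {x, y})"
    using assms by (auto simp: least_def Upper_def)
  then show ?thesis
    unfolding join_def sup_def by (blast intro: some_equality least_unique)
qed

lemma (in partial_order) meet_equality:
  assumes "x \<in> carrier L" "y \<in> carrier L" "z \<in> carrier L" "z \<sqsubseteq> x" "z \<sqsubseteq> y"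
    and "\<And>w. w \<in> carrier L \<Longrightarrow> w \<sqsubseteq> x \<Longrightarrow> w \<sqsubseteq> y \<Longrightarrow> w \<sqsubseteq> z"
  shows "x \<sqinter> y = z"
proof -
  have "greatest L z (Lower L {x, y})"
    using assms by (auto simp: greatest_def Lower_def)
  then show ?thesis
    unfolding meet_def inf_def by (blast intro: some_equality greatest_unique)
qed

lemma (in partial_order) latticeI:
  assumes "\<And>x y. x \<in> carrier L \<Longrightarrow> y \<in> carrier L \<Longrightarrow> \<exists>z\<in>carrier L. x \<sqsubseteq> z \<and> y \<sqsubseteq> z \<and>
      (\<forall>w\<in>carrier L. x \<sqsubseteq> w \<longrightarrow> y \<sqsubseteq> w \<longrightarrow> z \<sqsubseteq> w)"
    and "\<And>x y. x \<in> carrier L \<Longrightarrow> y \<in> carrier L \<Longrightarrow> \<exists>z\<in>carrier L. z \<sqsubseteq> x \<and> z \<sqsubseteq> y \<and>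
      (\<forall>w\<in>carrier L. w \<sqsubseteq> x \<longrightarrow> w \<sqsubseteq> y \<longrightarrow> w \<sqsubseteq> z)"
  shows "lattice L"
proof unfold_locales
  fix x y assume xy: "x \<in> carrier L" "y \<in> carrier L"
  show "\<exists>s. least L s (Upper L {x, y})"
    using assms(1)[OF xy] xy by (force simp: least_def Upper_def)
  show "\<exists>s. greatest L s (Lower L {x, y})"
    using assms(2)[OF xy] xy by (force simp: greatest_def Lower_def)
qed

lemma partial_orderI:
  assumes "eq P = (=)"
    and "\<And>x. x \<in> carrier P \<Longrightarrow> x \<sqsubseteq>\<^bsub>P\<^esub> x"
    and "\<And>x y. x \<in> carrier P \<Longrightarrow> y \<in> carrier P \<Longrightarrow> x \<sqsubseteq>\<^bsub>P\<^esub> y \<Longrightarrow> y \<sqsubseteq>\<^bsub>P\<^esub> x \<Longrightarrow> x = y"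
    and "\<And>x y z. x \<in> carrier P \<Longrightarrow> y \<in> carrier P \<Longrightarrow> z \<in> carrier P \<Longrightarrow>
      x \<sqsubseteq>\<^bsub>P\<^esub> y \<Longrightarrow> y \<sqsubseteq>\<^bsub>P\<^esub> z \<Longrightarrow> x \<sqsubseteq>\<^bsub>P\<^esub> z"
  shows "partial_order P"
proof unfold_locales
  fix x y z
  assume "x \<sqsubseteq>\<^bsub>P\<^esub> y" "y \<sqsubseteq>\<^bsub>P\<^esub> z" "x \<in> carrier P" "y \<in> carrier P" "z \<in> carrier P"
  then show "x \<sqsubseteq>\<^bsub>P\<^esub> z" by (metis assms(4))
qed (simp_all add: assms(1-3))

section \<open>Isomorphisms\<close>

lemma order_isomorphic_iff:
  assumes "partial_order P" "partial_order Q"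
  shows "order_isomorphic P Q \<longleftrightarrow> (\<exists>f. bij_betw f (carrier P) (carrier Q) \<and>
    (\<forall>x\<in>carrier P. \<forall>y\<in>carrier P. f x \<sqsubseteq>\<^bsub>Q\<^esub> f y \<longleftrightarrow> x \<sqsubseteq>\<^bsub>P\<^esub> y))"
  using assms unfolding order_isomorphic_def order_emb_def
  by (auto simp: partial_order_def)

lemma order_isomorphic_sym:
  assumes "order_isomorphic P Q"
  shows "order_isomorphic Q P"
proof -
  obtain f where f: "order_emb P Q f" "bij_betw f (carrier P) (carrier Q)"
    using assms by (auto simp: order_isomorphic_def)
  let ?g = "inv_into (carrier P) f"
  have g: "bij_betw ?g (carrier Q) (carrier P)"
    using f(2) by (rule bij_betw_inv_into)
  moreover have "order_emb Q P ?g"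
    unfolding order_emb_def
  proof (intro conjI ballI)
    fix x y assume "x \<in> carrier Q" "y \<in> carrier Q"
    then show "?g x \<sqsubseteq>\<^bsub>P\<^esub> ?g y \<longleftrightarrow> x \<sqsubseteq>\<^bsub>Q\<^esub> y"
      using f(1) bij_betwE[OF g] bij_betw_inv_into_right[OF f(2)]
      unfolding order_emb_def by metis
  qed (use f in \<open>auto simp: order_emb_def\<close>)
  ultimately show ?thesis by (auto simp: order_isomorphic_def)
qed

lemma order_isomorphic_trans:
  assumes "order_isomorphic P Q" "order_isomorphic Q R"
  shows "order_isomorphic P R"
proof -
  obtain f g where f: "order_emb P Q f" "bij_betw f (carrier P) (carrier Q)"
    and g: "order_emb Q R g" "bij_betw g (carrier Q) (carrier R)"
    using assms by (auto simp: order_isomorphic_def)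
  have "order_emb P R (g \<circ> f)"
    using f g by (auto simp: order_emb_def dest!: bij_betwE)
  with bij_betw_trans[OF f(2) g(2)] show ?thesis
    by (auto simp: order_isomorphic_def)
qed

locale order_iso = P: partial_order P + Q: partial_order Q
  for P :: "'a gorder" and Q :: "'b gorder" +
  fixes f :: "'a \<Rightarrow> 'b"
  assumes bij: "bij_betw f (carrier P) (carrier Q)"
    and mono: "\<And>x y. x \<in> carrier P \<Longrightarrow> y \<in> carrier P \<Longrightarrow> f x \<sqsubseteq>\<^bsub>Q\<^esub> f y \<longleftrightarrow> x \<sqsubseteq>\<^bsub>P\<^esub> y"
begin

lemma image: "carrier Q = f ` carrier P"
  using bij by (simp add: bij_betw_def)

lemma closed [simp, intro]: "x \<in> carrier P \<Longrightarrow> f x \<in> carrier Q"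
  by (simp add: image)

lemma inj: "inj_on f (carrier P)"
  using bij by (simp add: bij_betw_def)

lemma eq_iff: "x \<in> carrier P \<Longrightarrow> y \<in> carrier P \<Longrightarrow> f x = f y \<longleftrightarrow> x = y"
  using inj by (auto dest: inj_onD)

lemma isomorphic: "order_isomorphic P Q"
  using bij mono P.partial_order_axioms Q.partial_order_axioms
  by (auto simp: order_isomorphic_iff)

lemma lless_iff: "x \<in> carrier P \<Longrightarrow> y \<in> carrier P \<Longrightarrow> f x \<sqsubset>\<^bsub>Q\<^esub> f y \<longleftrightarrow> x \<sqsubset>\<^bsub>P\<^esub> y"
  by (simp add: lless_def mono P.eq_is_equal Q.eq_is_equal eq_iff)

lemma covered_by_iff:
  "x \<in> carrier P \<Longrightarrow> y \<in> carrier P \<Longrightarrow> covered_by Q (f x) (f y) \<longleftrightarrow> covered_by P x y"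
  by (auto simp: covered_by_def lless_iff image)

lemma poset_length_eq: "poset_length Q = poset_length P"
proof -
  have "(\<exists>c. (\<forall>i\<le>k. c i \<in> carrier Q) \<and> (\<forall>i<k. covered_by Q (c i) (c (Suc i)))) \<longleftrightarrow>
    (\<exists>c. (\<forall>i\<le>k. c i \<in> carrier P) \<and> (\<forall>i<k. covered_by P (c i) (c (Suc i))))"
    (is "?L \<longleftrightarrow> ?R") for k
  proof
    assume ?L
    then obtain c where c: "\<forall>i\<le>k. c i \<in> carrier Q" "\<forall>i<k. covered_by Q (c i) (c (Suc i))"
      by blast
    define d where "d = (\<lambda>i. inv_into (carrier P) f (c i))"
    have d: "d i \<in> carrier P \<and> f (d i) = c i" if "i \<le> k" for i
      using that c(1) bij unfolding d_def
      by (metis bij_betw_inv_into_right bij_betw_inv_into bij_betwE)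
    then have "\<forall>i<k. covered_by P (d i) (d (Suc i))"
      using c(2) by (metis Suc_leI covered_by_iff less_imp_le)
    with d show ?R by blast
  next
    assume ?R
    then obtain c where "\<forall>i\<le>k. c i \<in> carrier P" "\<forall>i<k. covered_by P (c i) (c (Suc i))"
      by blast
    then have "(\<forall>i\<le>k. f (c i) \<in> carrier Q) \<and> (\<forall>i<k. covered_by Q (f (c i)) (f (c (Suc i))))"
      by (simp add: covered_by_iff Suc_leI)
    then show ?L by (rule exI[of _ "\<lambda>i. f (c i)"])
  qed
  then show ?thesis by (simp add: poset_length_def)
qed

lemma least_iff: "x \<in> carrier P \<Longrightarrow> least Q (f x) (carrier Q) \<longleftrightarrow> least P x (carrier P)"
  by (auto simp: least_def image mono)

lemma greatest_iff: "x \<in> carrier P \<Longrightarrow> greatest Q (f x) (carrier Q) \<longleftrightarrow> greatest P x (carrier P)"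
  by (auto simp: greatest_def image mono)

context
  assumes lattice: "lattice P"
begin

interpretation P: lattice P by (fact lattice)

lemma join_image:
  assumes "x \<in> carrier P" "y \<in> carrier P"
  shows "f x \<squnion>\<^bsub>Q\<^esub> f y = f (x \<squnion>\<^bsub>P\<^esub> y)"
  by (rule Q.join_equality)
    (use assms in \<open>auto simp: image mono P.join_left P.join_right P.join_le\<close>)

lemma meet_image:
  assumes "x \<in> carrier P" "y \<in> carrier P"
  shows "f x \<sqinter>\<^bsub>Q\<^esub> f y = f (x \<sqinter>\<^bsub>P\<^esub> y)"
  by (rule Q.meet_equality)
    (use assms in \<open>auto simp: image mono P.meet_left P.meet_right P.meet_le\<close>)

lemma lattice_image: "lattice Q"
proof (rule Q.latticeI)
  fix x y assume "x \<in> carrier Q" "y \<in> carrier Q"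
  then obtain p q where pq: "p \<in> carrier P" "q \<in> carrier P" "x = f p" "y = f q"
    by (auto simp: image)
  show "\<exists>z\<in>carrier Q. x \<sqsubseteq>\<^bsub>Q\<^esub> z \<and> y \<sqsubseteq>\<^bsub>Q\<^esub> z \<and> (\<forall>w\<in>carrier Q. x \<sqsubseteq>\<^bsub>Q\<^esub> w \<longrightarrow> y \<sqsubseteq>\<^bsub>Q\<^esub> w \<longrightarrow> z \<sqsubseteq>\<^bsub>Q\<^esub> w)"
    by (rule bexI[of _ "f (p \<squnion>\<^bsub>P\<^esub> q)"])
      (use pq in \<open>auto simp: image mono P.join_left P.join_right P.join_le\<close>)
  show "\<exists>z\<in>carrier Q. z \<sqsubseteq>\<^bsub>Q\<^esub> x \<and> z \<sqsubseteq>\<^bsub>Q\<^esub> y \<and> (\<forall>w\<in>carrier Q. w \<sqsubseteq>\<^bsub>Q\<^esub> x \<longrightarrow> w \<sqsubseteq>\<^bsub>Q\<^esub> y \<longrightarrow> w \<sqsubseteq>\<^bsub>Q\<^esub> z)"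
    by (rule bexI[of _ "f (p \<sqinter>\<^bsub>P\<^esub> q)"])
      (use pq in \<open>auto simp: image mono P.meet_left P.meet_right P.meet_le\<close>)
qed

lemma semidistributive_image:
  assumes "semidistributive P"
  shows "semidistributive Q"
proof -
  have "f p \<squnion>\<^bsub>Q\<^esub> f q = f p \<squnion>\<^bsub>Q\<^esub> (f q \<sqinter>\<^bsub>Q\<^esub> f r)"
    if "p \<in> carrier P" "q \<in> carrier P" "r \<in> carrier P" "f p \<squnion>\<^bsub>Q\<^esub> f q = f p \<squnion>\<^bsub>Q\<^esub> f r" for p q r
  proof -
    have "p \<squnion>\<^bsub>P\<^esub> q = p \<squnion>\<^bsub>P\<^esub> r"
      using that by (simp add: join_image eq_iff)
    then have "p \<squnion>\<^bsub>P\<^esub> q = p \<squnion>\<^bsub>P\<^esub> (q \<sqinter>\<^bsub>P\<^esub> r)"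
      using assms that(1-3) unfolding semidistributive_def join_semidistributive_def by blast
    then show ?thesis
      using that(1-3) by (simp add: join_image meet_image)
  qed
  moreover have "f p \<sqinter>\<^bsub>Q\<^esub> f q = f p \<sqinter>\<^bsub>Q\<^esub> (f q \<squnion>\<^bsub>Q\<^esub> f r)"
    if "p \<in> carrier P" "q \<in> carrier P" "r \<in> carrier P" "f p \<sqinter>\<^bsub>Q\<^esub> f q = f p \<sqinter>\<^bsub>Q\<^esub> f r" for p q r
  proof -
    have "p \<sqinter>\<^bsub>P\<^esub> q = p \<sqinter>\<^bsub>P\<^esub> r"
      using that by (simp add: meet_image eq_iff)
    then have "p \<sqinter>\<^bsub>P\<^esub> q = p \<sqinter>\<^bsub>P\<^esub> (q \<squnion>\<^bsub>P\<^esub> r)"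
      using assms that(1-3) unfolding semidistributive_def meet_semidistributive_def by blast
    then show ?thesis
      using that(1-3) by (simp add: join_image meet_image)
  qed
  ultimately show ?thesis
    unfolding semidistributive_def join_semidistributive_def meet_semidistributive_def image ball_simps
    using lattice_image by blast
qed

lemma join_irreducibles_image: "join_irreducibles Q = f ` join_irreducibles P"
proof -
  have "f j \<in> join_irreducibles Q \<longleftrightarrow> j \<in> join_irreducibles P" if "j \<in> carrier P" for j
    unfolding join_irreducibles_def image mem_Collect_eq ball_simps
    using that by (simp add: join_image eq_iff flip: image add: least_iff cong: ball_cong)
  moreover have "join_irreducibles Q \<subseteq> f ` carrier P" "join_irreducibles P \<subseteq> carrier P"
    by (auto simp: join_irreducibles_def image)
  ultimately show ?thesis by blast
qed

lemma meet_irreducibles_image: "meet_irreducibles Q = f ` meet_irreducibles P"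
proof -
  have "f j \<in> meet_irreducibles Q \<longleftrightarrow> j \<in> meet_irreducibles P" if "j \<in> carrier P" for j
    unfolding meet_irreducibles_def image mem_Collect_eq ball_simps
    using that by (simp add: meet_image eq_iff flip: image add: greatest_iff cong: ball_cong)
  moreover have "meet_irreducibles Q \<subseteq> f ` carrier P" "meet_irreducibles P \<subseteq> carrier P"
    by (auto simp: meet_irreducibles_def image)
  ultimately show ?thesis by blast
qed

lemma card_join_irreducibles_image: "card (join_irreducibles Q) = card (join_irreducibles P)"
  unfolding join_irreducibles_image
  by (intro card_image inj_on_subset[OF inj]) (auto simp: join_irreducibles_def)

lemma card_meet_irreducibles_image: "card (meet_irreducibles Q) = card (meet_irreducibles P)"
  unfolding meet_irreducibles_image
  by (intro card_image inj_on_subset[OF inj]) (auto simp: meet_irreducibles_def)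

end

end

lemma order_isomorphicE:
  assumes "order_isomorphic P Q" "partial_order P" "partial_order Q"
  obtains f where "order_iso P Q f"
  using assms by (auto simp: order_isomorphic_iff order_iso_def order_iso_axioms_def)

section \<open>Doubling an interval\<close>

locale interval_doubling = lattice P for P :: "'a gorder" (structure) +
  fixes a b :: 'a
  assumes a: "a \<in> carrier P" and b: "b \<in> carrier P" and ab: "a \<sqsubseteq> b"
begin

abbreviation D :: "('a \<times> nat) gorder" where "D \<equiv> doubling P \<lbrace>a..b\<rbrace>"

lemma down_closure_interval: "down_closure P \<lbrace>a..b\<rbrace> = {p \<in> carrier P. p \<sqsubseteq> b}"
  using a b ab by (auto simp: down_closure_def at_least_at_most_def intro: le_trans)

lemma mem_carrier_D:
  "(p, i) \<in> carrier D \<longleftrightarrow>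
    p \<in> carrier P \<and> (i = 1 \<and> p \<sqsubseteq> b \<or> i = 2 \<and> (\<not> p \<sqsubseteq> b \<or> a \<sqsubseteq> p))"
  unfolding doubling_def down_closure_interval by (auto simp: at_least_at_most_def)

lemma le_D: "(p, i) \<sqsubseteq>\<^bsub>D\<^esub> (q, j) \<longleftrightarrow> p \<sqsubseteq> q \<and> i \<le> j"
  by (simp add: doubling_def)

lemma partial_order_D: "partial_order D"
proof (rule partial_orderI)
  show "eq D = (=)" by (simp add: doubling_def)
qed (auto simp: mem_carrier_D le_D intro: le_trans)

interpretation D: partial_order D by (fact partial_order_D)

lemma join_D:
  assumes "(p, i) \<in> carrier D" "(q, j) \<in> carrier D"
  defines "z \<equiv> (p \<squnion> q, if p \<squnion> q \<sqsubseteq> b then max i j else 2)"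
  shows "z \<in> carrier D \<and> (p, i) \<sqsubseteq>\<^bsub>D\<^esub> z \<and> (q, j) \<sqsubseteq>\<^bsub>D\<^esub> z \<and>
    (\<forall>w\<in>carrier D. (p, i) \<sqsubseteq>\<^bsub>D\<^esub> w \<longrightarrow> (q, j) \<sqsubseteq>\<^bsub>D\<^esub> w \<longrightarrow> z \<sqsubseteq>\<^bsub>D\<^esub> w)" (is ?th)
    and "(p, i) \<squnion>\<^bsub>D\<^esub> (q, j) = z"
proof -
  have pq: "p \<in> carrier P" "q \<in> carrier P" and j: "p \<squnion> q \<in> carrier P"
    using assms by (auto simp: mem_carrier_D)
  note jl = join_left[OF pq] join_right[OF pq]
  have below: "p \<squnion> q \<sqsubseteq> r \<longleftrightarrow> p \<sqsubseteq> r \<and> q \<sqsubseteq> r" if "r \<in> carrier P" for r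
    using that pq j jl by (meson join_le le_trans)
  have above: "a \<sqsubseteq> p \<squnion> q" if "a \<sqsubseteq> p \<or> a \<sqsubseteq> q"
    using that a pq j jl by (meson le_trans)
  show th: ?th
    using assms a b pq j jl below above
    by (auto simp: mem_carrier_D le_D split: if_splits)
  then show "(p, i) \<squnion>\<^bsub>D\<^esub> (q, j) = z"
    using assms by (intro D.join_equality) auto
qed

lemma meet_D:
  assumes "(p, i) \<in> carrier D" "(q, j) \<in> carrier D"
  defines "z \<equiv> (p \<sqinter> q, if a \<sqsubseteq> p \<sqinter> q \<or> \<not> p \<sqinter> q \<sqsubseteq> b then min i j else 1)"
  shows "z \<in> carrier D \<and> z \<sqsubseteq>\<^bsub>D\<^esub> (p, i) \<and> z \<sqsubseteq>\<^bsub>D\<^esub> (q, j) \<and>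
    (\<forall>w\<in>carrier D. w \<sqsubseteq>\<^bsub>D\<^esub> (p, i) \<longrightarrow> w \<sqsubseteq>\<^bsub>D\<^esub> (q, j) \<longrightarrow> w \<sqsubseteq>\<^bsub>D\<^esub> z)" (is ?th)
    and "(p, i) \<sqinter>\<^bsub>D\<^esub> (q, j) = z"
proof -
  have pq: "p \<in> carrier P" "q \<in> carrier P" and j: "p \<sqinter> q \<in> carrier P"
    using assms by (auto simp: mem_carrier_D)
  note jl = meet_left[OF pq] meet_right[OF pq]
  have above: "r \<sqsubseteq> p \<sqinter> q \<longleftrightarrow> r \<sqsubseteq> p \<and> r \<sqsubseteq> q" if "r \<in> carrier P" for r
    using that pq j jl by (meson meet_le le_trans)
  have below: "p \<sqinter> q \<sqsubseteq> b" if "p \<sqsubseteq> b \<or> q \<sqsubseteq> b"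
    using that b pq j jl by (meson le_trans)
  have up: "a \<sqsubseteq> s" if "a \<sqsubseteq> r" "r \<sqsubseteq> s" "r \<in> carrier P" "s \<in> carrier P" for r s
    using that a by (meson le_trans)
  have down: "r \<sqsubseteq> b" if "s \<sqsubseteq> b" "r \<sqsubseteq> s" "r \<in> carrier P" "s \<in> carrier P" for r s
    using that b by (meson le_trans)
  show th: ?th
  proof (intro conjI ballI impI)
    show "z \<in> carrier D"
      using assms j above[OF a] below by (auto simp: mem_carrier_D z_def min_def)
    show "z \<sqsubseteq>\<^bsub>D\<^esub> (p, i)" "z \<sqsubseteq>\<^bsub>D\<^esub> (q, j)"
      using assms(1,2) jl by (auto simp: mem_carrier_D z_def le_D)
    fix w assume w: "w \<in> carrier D" "w \<sqsubseteq>\<^bsub>D\<^esub> (p, i)" "w \<sqsubseteq>\<^bsub>D\<^esub> (q, j)"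
    obtain r k where rk: "w = (r, k)" by fastforce
    have r: "r \<in> carrier P" "r \<sqsubseteq> p \<sqinter> q" "k \<le> min i j"
      using w above by (auto simp: rk mem_carrier_D le_D)
    show "w \<sqsubseteq>\<^bsub>D\<^esub> z"
      using w(1) r up[OF _ r(2,1) j] down[OF _ r(2,1) j] by (auto simp: rk mem_carrier_D le_D z_def)
  qed
  then show "(p, i) \<sqinter>\<^bsub>D\<^esub> (q, j) = z"
    using assms by (intro D.meet_equality) auto
qed

lemma lattice_D: "lattice D"
proof (rule D.latticeI)
  fix x y assume xy: "x \<in> carrier D" "y \<in> carrier D"
  obtain p i q j where [simp]: "x = (p, i)" "y = (q, j)" by fastforce
  show "\<exists>z\<in>carrier D. x \<sqsubseteq>\<^bsub>D\<^esub> z \<and> y \<sqsubseteq>\<^bsub>D\<^esub> z \<and> (\<forall>w\<in>carrier D. x \<sqsubseteq>\<^bsub>D\<^esub> w \<longrightarrow> y \<sqsubseteq>\<^bsub>D\<^esub> w \<longrightarrow> z \<sqsubseteq>\<^bsub>D\<^esub> w)"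
    using join_D(1)[of p i q j] xy by (simp del: split_paired_Ex) blast
  show "\<exists>z\<in>carrier D. z \<sqsubseteq>\<^bsub>D\<^esub> x \<and> z \<sqsubseteq>\<^bsub>D\<^esub> y \<and> (\<forall>w\<in>carrier D. w \<sqsubseteq>\<^bsub>D\<^esub> x \<longrightarrow> w \<sqsubseteq>\<^bsub>D\<^esub> y \<longrightarrow> w \<sqsubseteq>\<^bsub>D\<^esub> z)"
    using meet_D(1)[of p i q j] xy by (simp del: split_paired_Ex) blast
qed

lemma semidistributive_D:
  assumes "semidistributive P"
  shows "semidistributive D"
proof -
  have jsd: "p \<squnion> q = p \<squnion> (q \<sqinter> r)"
    if "p \<squnion> q = p \<squnion> r" "p \<in> carrier P" "q \<in> carrier P" "r \<in> carrier P" for p q r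
    using assms that unfolding semidistributive_def join_semidistributive_def by blast
  have msd: "p \<sqinter> q = p \<sqinter> (q \<squnion> r)"
    if "p \<sqinter> q = p \<sqinter> r" "p \<in> carrier P" "q \<in> carrier P" "r \<in> carrier P" for p q r
    using assms that unfolding semidistributive_def meet_semidistributive_def by blast
  have "x \<squnion>\<^bsub>D\<^esub> y = x \<squnion>\<^bsub>D\<^esub> (y \<sqinter>\<^bsub>D\<^esub> z)"
    if D: "x \<in> carrier D" "y \<in> carrier D" "z \<in> carrier D" and eq: "x \<squnion>\<^bsub>D\<^esub> y = x \<squnion>\<^bsub>D\<^esub> z" for x y z
  proof -
    obtain p i q j r k where xyz: "x = (p, i)" "y = (q, j)" "z = (r, k)"
      by (cases x, cases y, cases z) blast
    have P: "p \<in> carrier P" "q \<in> carrier P" "r \<in> carrier P"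
      using D by (auto simp: xyz mem_carrier_D)
    define l where "l = (if a \<sqsubseteq> q \<sqinter> r \<or> \<not> q \<sqinter> r \<sqsubseteq> b then min j k else 1)"
    have m: "y \<sqinter>\<^bsub>D\<^esub> z = (q \<sqinter> r, l)" "(q \<sqinter> r, l) \<in> carrier D"
      using meet_D[of q j r k] D by (auto simp: xyz l_def)
    have j: "p \<squnion> q = p \<squnion> r" "p \<squnion> q \<sqsubseteq> b \<Longrightarrow> max i j = max i k"
      using eq D by (auto simp: xyz join_D split: if_splits)
    note j' = jsd[OF j(1) P]
    have "max i j = max i l" if *: "p \<squnion> q \<sqsubseteq> b"
    proof -
      have "q \<sqsubseteq> b" "r \<sqsubseteq> b"
        using * j(1) P b by (metis join_closed join_right le_trans)+
      then have "a \<sqsubseteq> q \<sqinter> r" if "j = 2" "k = 2"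
        using that D P a by (auto simp: xyz mem_carrier_D intro: meet_le)
      then show ?thesis
        using j(2)[OF *] D by (auto simp: xyz mem_carrier_D l_def)
    qed
    then show ?thesis
      using D m j' by (simp add: xyz join_D)
  qed
  moreover have "x \<sqinter>\<^bsub>D\<^esub> y = x \<sqinter>\<^bsub>D\<^esub> (y \<squnion>\<^bsub>D\<^esub> z)"
    if D: "x \<in> carrier D" "y \<in> carrier D" "z \<in> carrier D" and eq: "x \<sqinter>\<^bsub>D\<^esub> y = x \<sqinter>\<^bsub>D\<^esub> z" for x y z
  proof -
    obtain p i q j r k where xyz: "x = (p, i)" "y = (q, j)" "z = (r, k)"
      by (cases x, cases y, cases z) blast
    have P: "p \<in> carrier P" "q \<in> carrier P" "r \<in> carrier P"
      using D by (auto simp: xyz mem_carrier_D)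
    define l where "l = (if q \<squnion> r \<sqsubseteq> b then max j k else 2)"
    have m: "y \<squnion>\<^bsub>D\<^esub> z = (q \<squnion> r, l)" "(q \<squnion> r, l) \<in> carrier D"
      using join_D[of q j r k] D by (auto simp: xyz l_def)
    have j: "p \<sqinter> q = p \<sqinter> r" "a \<sqsubseteq> p \<sqinter> q \<or> \<not> p \<sqinter> q \<sqsubseteq> b \<Longrightarrow> min i j = min i k"
      using eq D by (auto simp: xyz meet_D split: if_splits)
    note j' = msd[OF j(1) P]
    have "min i j = min i l" if *: "a \<sqsubseteq> p \<sqinter> q \<or> \<not> p \<sqinter> q \<sqsubseteq> b"
    proof -
      have "q \<squnion> r \<sqsubseteq> b" if "j = 1" "k = 1"
        using that D P b by (auto simp: xyz mem_carrier_D intro: join_le)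
      then show ?thesis
        using j(2)[OF *] D by (auto simp: xyz mem_carrier_D l_def)
    qed
    then show ?thesis
      using D m j' by (simp add: xyz meet_D)
  qed
  ultimately show ?thesis
    unfolding semidistributive_def join_semidistributive_def meet_semidistributive_def
    using lattice_D by blast
qed

lemma least_D: "least D (p, i) (carrier D) \<longleftrightarrow> least P p (carrier P) \<and> i = 1"
proof
  assume *: "least D (p, i) (carrier D)"
  then have pi: "(p, i) \<in> carrier D" and le: "\<And>q j. (q, j) \<in> carrier D \<Longrightarrow> p \<sqsubseteq> q \<and> i \<le> j"
    by (auto simp: least_def le_D)
  have "p \<sqsubseteq> q" if "q \<in> carrier P" for q
    using le[of q 1] le[of q 2] that by (cases "q \<sqsubseteq> b") (auto simp: mem_carrier_D)
  moreover have "i = 1"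
    using le[of b 1] pi b by (auto simp: mem_carrier_D)
  ultimately show "least P p (carrier P) \<and> i = 1"
    using pi by (auto simp: least_def mem_carrier_D)
next
  assume "least P p (carrier P) \<and> i = 1"
  then show "least D (p, i) (carrier D)"
    using b by (auto simp: least_def mem_carrier_D le_D)
qed

lemma greatest_D: "greatest D (p, i) (carrier D) \<longleftrightarrow> greatest P p (carrier P) \<and> i = 2"
proof
  assume *: "greatest D (p, i) (carrier D)"
  then have pi: "(p, i) \<in> carrier D" and le: "\<And>q j. (q, j) \<in> carrier D \<Longrightarrow> q \<sqsubseteq> p \<and> j \<le> i"
    by (auto simp: greatest_def le_D)
  have "q \<sqsubseteq> p" if "q \<in> carrier P" for q
    using le[of q 1] le[of q 2] that by (cases "q \<sqsubseteq> b") (auto simp: mem_carrier_D)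
  moreover have "i = 2"
    using le[of a 2] pi a by (auto simp: mem_carrier_D)
  ultimately show "greatest P p (carrier P) \<and> i = 2"
    using pi by (auto simp: greatest_def mem_carrier_D)
next
  assume "greatest P p (carrier P) \<and> i = 2"
  then show "greatest D (p, i) (carrier D)"
    using a by (auto simp: greatest_def mem_carrier_D le_D)
qed

lemma join_irreducible_D_low:
  assumes "j \<in> carrier P" "j \<sqsubseteq> b"
  shows "(j, 1) \<in> join_irreducibles D \<longleftrightarrow> j \<in> join_irreducibles P"
proof
  assume J: "(j, 1) \<in> join_irreducibles D"
  have "j = p \<or> j = q" if "p \<in> carrier P" "q \<in> carrier P" "j = p \<squnion> q" for p q
  proof -
    have "p \<sqsubseteq> b" "q \<sqsubseteq> b"
      using that assms b by (metis join_closed join_left join_right le_trans)+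
    then have "(p, 1) \<in> carrier D" "(q, 1) \<in> carrier D" "(j, 1) = (p, 1) \<squnion>\<^bsub>D\<^esub> (q, 1)"
      using that assms by (auto simp: mem_carrier_D join_D)
    then show ?thesis using J by (force simp: join_irreducibles_def)
  qed
  then show "j \<in> join_irreducibles P"
    using J assms by (simp add: join_irreducibles_def least_D)
next
  assume J: "j \<in> join_irreducibles P"
  have "(j, 1) = x \<or> (j, 1) = y"
    if xy: "x \<in> carrier D" "y \<in> carrier D" "(j, 1) = x \<squnion>\<^bsub>D\<^esub> y" for x y
  proof -
    obtain p i q k where [simp]: "x = (p, i)" "y = (q, k)" by fastforce
    have *: "j = p \<squnion> q" "max i k = 1"
      using xy assms(2) by (auto simp: join_D split: if_splits)
    then have "i = 1" "k = 1"
      using xy(1,2) by (auto simp: mem_carrier_D max_def split: if_splits)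
    moreover have "j = p \<or> j = q"
      using *(1) J xy by (auto simp: join_irreducibles_def mem_carrier_D)
    ultimately show ?thesis by auto
  qed
  then show "(j, 1) \<in> join_irreducibles D"
    using J assms by (simp add: join_irreducibles_def least_D mem_carrier_D)
qed

lemma join_irreducible_D_high:
  assumes "j \<in> carrier P" "\<not> j \<sqsubseteq> b"
  shows "(j, 2) \<in> join_irreducibles D \<longleftrightarrow> j \<in> join_irreducibles P"
proof
  assume J: "(j, 2) \<in> join_irreducibles D"
  have "\<not> least P j (carrier P)"
    using assms b by (auto simp: least_def)
  moreover have "j = p \<or> j = q" if pq: "p \<in> carrier P" "q \<in> carrier P" "j = p \<squnion> q" for p q
  proof -
    define c :: "'a \<Rightarrow> nat" where "c r = (if r \<sqsubseteq> b then 1 else 2)" for r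
    have "(p, c p) \<in> carrier D" "(q, c q) \<in> carrier D"
      using pq by (auto simp: mem_carrier_D c_def)
    moreover from this have "(j, 2) = (p, c p) \<squnion>\<^bsub>D\<^esub> (q, c q)"
      using pq assms by (simp add: join_D)
    ultimately show ?thesis using J by (force simp: join_irreducibles_def)
  qed
  ultimately show "j \<in> join_irreducibles P"
    using assms by (simp add: join_irreducibles_def)
next
  assume J: "j \<in> join_irreducibles P"
  have "(j, 2) = x \<or> (j, 2) = y"
    if xy: "x \<in> carrier D" "y \<in> carrier D" "(j, 2) = x \<squnion>\<^bsub>D\<^esub> y" for x y
  proof -
    obtain p i q k where [simp]: "x = (p, i)" "y = (q, k)" by fastforce
    have "j = p \<squnion> q"
      using xy by (auto simp: join_D)
    then have "j = p \<or> j = q"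
      using J xy by (auto simp: join_irreducibles_def mem_carrier_D)
    then show ?thesis
      using xy(1,2) assms by (auto simp: mem_carrier_D)
  qed
  then show "(j, 2) \<in> join_irreducibles D"
    using J assms by (simp add: join_irreducibles_def least_D mem_carrier_D)
qed

lemma join_irreducible_D_interval:
  assumes "j \<in> carrier P" "a \<sqsubseteq> j" "j \<sqsubseteq> b"
  shows "(j, 2) \<in> join_irreducibles D \<longleftrightarrow> j = a"
proof
  assume J: "(j, 2) \<in> join_irreducibles D"
  have "j \<squnion> a = j"
    using assms a by (intro join_equality) auto
  then have "(j, 1) \<in> carrier D" "(a, 2) \<in> carrier D" "(j, 2) = (j, 1) \<squnion>\<^bsub>D\<^esub> (a, 2)"
    using assms a by (auto simp: mem_carrier_D join_D)
  then show "j = a" using J by (force simp: join_irreducibles_def)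
next
  assume [simp]: "j = a"
  have "(a, 2) = x \<or> (a, 2) = y"
    if xy: "x \<in> carrier D" "y \<in> carrier D" "(a, 2) = x \<squnion>\<^bsub>D\<^esub> y" for x y
  proof -
    obtain p i q k where [simp]: "x = (p, i)" "y = (q, k)" by fastforce
    have P: "p \<in> carrier P" "q \<in> carrier P" using xy by (auto simp: mem_carrier_D)
    have *: "a = p \<squnion> q" "max i k = 2"
      using xy ab by (auto simp: join_D split: if_splits)
    then have "p \<sqsubseteq> a" "q \<sqsubseteq> a" using P by (auto simp: join_left join_right)
    moreover from this have "p \<sqsubseteq> b" "q \<sqsubseteq> b"
      using P a b ab by (blast intro: le_trans)+
    moreover have "i = 2 \<or> k = 2" using *(2) by (auto simp: max_def split: if_splits)
    ultimately show ?thesis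
      using xy(1,2) P a by (auto simp: mem_carrier_D)
  qed
  then show "(j, 2) \<in> join_irreducibles D"
    using a by (simp add: join_irreducibles_def least_D mem_carrier_D)
qed

lemma join_irreducibles_D:
  "join_irreducibles D =
    insert (a, 2) ((\<lambda>j. (j, if j \<sqsubseteq> b then 1 else 2)) ` join_irreducibles P)" (is "_ = ?R")
proof -
  have "(j, i) \<in> join_irreducibles D \<longleftrightarrow> (j, i) \<in> ?R" for j i
  proof (cases "(j, i) \<in> carrier D")
    case True
    then have "j \<in> carrier P" and "i = 1 \<and> j \<sqsubseteq> b \<or> i = 2 \<and> \<not> j \<sqsubseteq> b \<or> i = 2 \<and> a \<sqsubseteq> j \<and> j \<sqsubseteq> b"
      by (auto simp: mem_carrier_D)
    then show ?thesis
      using a ab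
      by (auto simp: join_irreducible_D_low[unfolded One_nat_def] join_irreducible_D_high
          join_irreducible_D_interval image_iff)
  next
    case False
    moreover have "(j, i) \<in> carrier D" if "(j, i) \<in> ?R"
      using that a ab by (auto simp: join_irreducibles_def mem_carrier_D split: if_splits)
    ultimately show ?thesis by (auto simp: join_irreducibles_def)
  qed
  then show ?thesis by (simp add: set_eq_iff)
qed

lemma meet_irreducible_D_high:
  assumes "j \<in> carrier P" "\<not> j \<sqsubseteq> b \<or> a \<sqsubseteq> j"
  shows "(j, 2) \<in> meet_irreducibles D \<longleftrightarrow> j \<in> meet_irreducibles P"
proof
  assume J: "(j, 2) \<in> meet_irreducibles D"
  have "j = p \<or> j = q" if "p \<in> carrier P" "q \<in> carrier P" "j = p \<sqinter> q" for p q
  proof -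
    have "j \<sqsubseteq> p" "j \<sqsubseteq> q" using that by (auto simp: meet_left meet_right)
    then have "\<not> p \<sqsubseteq> b \<or> a \<sqsubseteq> p" "\<not> q \<sqsubseteq> b \<or> a \<sqsubseteq> q"
      using assms that(1,2) a b by (blast intro: le_trans)+
    then have "(p, 2) \<in> carrier D" "(q, 2) \<in> carrier D" "(j, 2) = (p, 2) \<sqinter>\<^bsub>D\<^esub> (q, 2)"
      using that assms by (auto simp: mem_carrier_D meet_D)
    then show ?thesis using J by (force simp: meet_irreducibles_def)
  qed
  then show "j \<in> meet_irreducibles P"
    using J assms by (simp add: meet_irreducibles_def greatest_D)
next
  assume J: "j \<in> meet_irreducibles P"
  have "(j, 2) = x \<or> (j, 2) = y"
    if xy: "x \<in> carrier D" "y \<in> carrier D" "(j, 2) = x \<sqinter>\<^bsub>D\<^esub> y" for x y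
  proof -
    obtain p i q k where [simp]: "x = (p, i)" "y = (q, k)" by fastforce
    have *: "j = p \<sqinter> q" "min i k = 2"
      using xy assms(2) by (auto simp: meet_D split: if_splits)
    then have "i = 2" "k = 2"
      using xy(1,2) by (auto simp: mem_carrier_D min_def split: if_splits)
    moreover have "j = p \<or> j = q"
      using *(1) J xy by (auto simp: meet_irreducibles_def mem_carrier_D)
    ultimately show ?thesis by auto
  qed
  then show "(j, 2) \<in> meet_irreducibles D"
    using J assms by (simp add: meet_irreducibles_def greatest_D mem_carrier_D)
qed

lemma meet_irreducible_D_low:
  assumes "j \<in> carrier P" "j \<sqsubseteq> b" "\<not> a \<sqsubseteq> j"
  shows "(j, 1) \<in> meet_irreducibles D \<longleftrightarrow> j \<in> meet_irreducibles P"
proof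
  assume J: "(j, 1) \<in> meet_irreducibles D"
  have "\<not> greatest P j (carrier P)"
    using assms a by (auto simp: greatest_def)
  moreover have "j = p \<or> j = q" if pq: "p \<in> carrier P" "q \<in> carrier P" "j = p \<sqinter> q" for p q
  proof -
    define c :: "'a \<Rightarrow> nat" where "c r = (if \<not> r \<sqsubseteq> b \<or> a \<sqsubseteq> r then 2 else 1)" for r
    have "(p, c p) \<in> carrier D" "(q, c q) \<in> carrier D"
      using pq by (auto simp: mem_carrier_D c_def)
    moreover from this have "(j, 1) = (p, c p) \<sqinter>\<^bsub>D\<^esub> (q, c q)"
      using pq assms by (simp add: meet_D)
    ultimately show ?thesis using J by (force simp: meet_irreducibles_def)
  qed
  ultimately show "j \<in> meet_irreducibles P"
    using assms by (simp add: meet_irreducibles_def)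
next
  assume J: "j \<in> meet_irreducibles P"
  have "(j, 1) = x \<or> (j, 1) = y"
    if xy: "x \<in> carrier D" "y \<in> carrier D" "(j, 1) = x \<sqinter>\<^bsub>D\<^esub> y" for x y
  proof -
    obtain p i q k where [simp]: "x = (p, i)" "y = (q, k)" by fastforce
    have "j = p \<sqinter> q"
      using xy by (auto simp: meet_D)
    then have "j = p \<or> j = q"
      using J xy by (auto simp: meet_irreducibles_def mem_carrier_D)
    then show ?thesis
      using xy(1,2) assms by (auto simp: mem_carrier_D)
  qed
  then show "(j, 1) \<in> meet_irreducibles D"
    using J assms by (simp add: meet_irreducibles_def greatest_D mem_carrier_D)
qed

lemma meet_irreducible_D_interval:
  assumes "j \<in> carrier P" "a \<sqsubseteq> j" "j \<sqsubseteq> b"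
  shows "(j, 1) \<in> meet_irreducibles D \<longleftrightarrow> j = b"
proof
  assume J: "(j, 1) \<in> meet_irreducibles D"
  have "j \<sqinter> b = j"
    using assms b by (intro meet_equality) auto
  then have "(j, 2) \<in> carrier D" "(b, 1) \<in> carrier D" "(j, 1) = (j, 2) \<sqinter>\<^bsub>D\<^esub> (b, 1)"
    using assms b by (auto simp: mem_carrier_D meet_D)
  then show "j = b" using J by (force simp: meet_irreducibles_def)
next
  assume [simp]: "j = b"
  have "(b, 1) = x \<or> (b, 1) = y"
    if xy: "x \<in> carrier D" "y \<in> carrier D" "(b, 1) = x \<sqinter>\<^bsub>D\<^esub> y" for x y
  proof -
    obtain p i q k where [simp]: "x = (p, i)" "y = (q, k)" by fastforce
    have P: "p \<in> carrier P" "q \<in> carrier P" using xy by (auto simp: mem_carrier_D)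
    have *: "b = p \<sqinter> q" "min i k = 1"
      using xy ab by (auto simp: meet_D split: if_splits)
    then have "b \<sqsubseteq> p" "b \<sqsubseteq> q" using P by (auto simp: meet_left meet_right)
    moreover have "i = 1 \<or> k = 1" using *(2) by (auto simp: min_def split: if_splits)
    ultimately show ?thesis
      using xy(1,2) P b by (auto simp: mem_carrier_D)
  qed
  then show "(j, 1) \<in> meet_irreducibles D"
    using b by (simp add: meet_irreducibles_def greatest_D mem_carrier_D)
qed

lemma meet_irreducibles_D:
  "meet_irreducibles D =
    insert (b, 1) ((\<lambda>j. (j, if \<not> j \<sqsubseteq> b \<or> a \<sqsubseteq> j then 2 else 1)) ` meet_irreducibles P)" (is "_ = ?R")
proof -
  have "(j, i) \<in> meet_irreducibles D \<longleftrightarrow> (j, i) \<in> ?R" for j i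
  proof (cases "(j, i) \<in> carrier D")
    case True
    then have "j \<in> carrier P" and "i = 2 \<and> (\<not> j \<sqsubseteq> b \<or> a \<sqsubseteq> j) \<or> i = 1 \<and> j \<sqsubseteq> b \<and> \<not> a \<sqsubseteq> j \<or>
        i = 1 \<and> a \<sqsubseteq> j \<and> j \<sqsubseteq> b"
      by (auto simp: mem_carrier_D)
    then show ?thesis
      using b ab
      by (auto simp: meet_irreducible_D_low[unfolded One_nat_def] meet_irreducible_D_high
          meet_irreducible_D_interval[unfolded One_nat_def] image_iff)
  next
    case False
    moreover have "(j, i) \<in> carrier D" if "(j, i) \<in> ?R"
      using that b ab by (auto simp: meet_irreducibles_def mem_carrier_D split: if_splits)
    ultimately show ?thesis by (auto simp: meet_irreducibles_def)
  qed
  then show ?thesis by (simp add: set_eq_iff)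
qed

lemma card_irreducibles_D:
  assumes "finite (carrier P)"
  shows "card (join_irreducibles D) = Suc (card (join_irreducibles P))"
    and "card (meet_irreducibles D) = Suc (card (meet_irreducibles P))"
proof -
  have "finite (join_irreducibles P)" "finite (meet_irreducibles P)"
    using assms by (auto simp: join_irreducibles_def meet_irreducibles_def)
  then show "card (join_irreducibles D) = Suc (card (join_irreducibles P))"
    and "card (meet_irreducibles D) = Suc (card (meet_irreducibles P))"
    unfolding join_irreducibles_D meet_irreducibles_D
    using ab by (subst card_insert_disjoint; auto simp: card_image inj_on_def)+
qed

lemma finite_D: "finite (carrier P) \<Longrightarrow> finite (carrier D)"
  by (rule finite_subset[of _ "carrier P \<times> {1, 2}"]) (auto simp: mem_carrier_D)

end

lemma doubling_isomorphic:
  assumes "interval_doubling P a b" "order_iso P Q f"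
  shows "order_isomorphic (doubling P \<lbrace>a..b\<rbrace>\<^bsub>P\<^esub>) (doubling Q \<lbrace>f a..f b\<rbrace>\<^bsub>Q\<^esub>)"
proof -
  interpret I: interval_doubling P a b by fact
  interpret f: order_iso P Q f by fact
  have "interval_doubling Q (f a) (f b)"
    using f.lattice_image[OF I.lattice_axioms] I.a I.b I.ab
    by (simp add: interval_doubling_def interval_doubling_axioms_def f.mono)
  then interpret J: interval_doubling Q "f a" "f b" .
  have "order_iso I.D J.D (map_prod f id)"
  proof (intro order_iso.intro I.partial_order_D J.partial_order_D order_iso_axioms.intro)
    show "bij_betw (map_prod f id) (carrier I.D) (carrier J.D)"
      unfolding bij_betw_def
    proof
      show "inj_on (map_prod f id) (carrier I.D)"
        by (auto simp: inj_on_def I.mem_carrier_D f.eq_iff)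
      show "map_prod f id ` carrier I.D = carrier J.D"
      proof (intro equalityI subsetI)
        fix x assume "x \<in> map_prod f id ` carrier I.D"
        then show "x \<in> carrier J.D"
          using I.a I.b by (auto simp: I.mem_carrier_D J.mem_carrier_D f.mono)
      next
        fix x assume x: "x \<in> carrier J.D"
        obtain q i where qi: "x = (q, i)" by fastforce
        then obtain p where p: "p \<in> carrier P" "q = f p"
          using x by (auto simp: J.mem_carrier_D f.image)
        then have "(p, i) \<in> carrier I.D"
          using x I.a I.b by (auto simp: qi I.mem_carrier_D J.mem_carrier_D f.mono)
        then show "x \<in> map_prod f id ` carrier I.D"
          by (force simp: qi p)
      qed
    qed
  qed (auto simp: I.mem_carrier_D I.le_D J.le_D f.mono)
  then show ?thesis by (rule order_iso.isomorphic)
qed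

lemma order_isomorphic_nat_copy:
  assumes "partial_order P" "finite (carrier P)"
  obtains Q :: "nat gorder" where "partial_order Q" "order_isomorphic P Q"
proof -
  interpret partial_order P by fact
  obtain h :: "'a \<Rightarrow> nat" where h: "inj_on h (carrier P)"
    using finite_imp_inj_to_nat_seg[OF assms(2)] by blast
  define Q :: "nat gorder" where "Q = \<lparr>carrier = h ` carrier P, eq = (=),
    le = (\<lambda>x y. inv_into (carrier P) h x \<sqsubseteq>\<^bsub>P\<^esub> inv_into (carrier P) h y)\<rparr>"
  have le: "h x \<sqsubseteq>\<^bsub>Q\<^esub> h y \<longleftrightarrow> x \<sqsubseteq>\<^bsub>P\<^esub> y" if "x \<in> carrier P" "y \<in> carrier P" for x y
    using that h by (simp add: Q_def)
  have c: "carrier Q = h ` carrier P" by (simp add: Q_def)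
  have "partial_order Q"
  proof (rule partial_orderI)
    show "eq Q = (=)" by (simp add: Q_def)
    fix x y assume "x \<in> carrier Q" "y \<in> carrier Q" "x \<sqsubseteq>\<^bsub>Q\<^esub> y" "y \<sqsubseteq>\<^bsub>Q\<^esub> x"
    then show "x = y" by (auto simp: c le dest: le_antisym)
  qed (auto simp: c le intro: le_trans)
  then have "order_iso P Q h"
    using h by (auto simp: order_iso_def order_iso_axioms_def assms(1) c le bij_betw_def)
  with \<open>partial_order Q\<close> that show thesis
    by (blast intro: order_iso.isomorphic)
qed

definition doubling_lattice :: "nat \<Rightarrow> 'a gorder \<Rightarrow> bool" where
  "doubling_lattice k P \<longleftrightarrow> semidistributive P \<and> constructable_by_interval_doublings P \<and>
    card (join_irreducibles P) = k \<and> card (meet_irreducibles P) = k"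

lemma doubling_latticeD:
  assumes "doubling_lattice k P"
  shows "lattice P" "finite (carrier P)" "partial_order P"
  using assms
  by (auto simp: doubling_lattice_def constructable_by_interval_doublings_def
      lattice_def upper_semilattice_def)

lemma obtained_by_interval_doublings_partial_order:
  "obtained_by_interval_doublings P \<Longrightarrow> partial_order P"
  by (induction rule: obtained_by_interval_doublings.induct)

lemma doubling_lattice_isomorphic:
  assumes P: "doubling_lattice k P" and iso: "order_isomorphic P Q" and Q: "partial_order Q"
  shows "doubling_lattice k Q"
proof -
  note P' = doubling_latticeD[OF P]
  obtain f where "order_iso P Q f" using order_isomorphicE[OF iso P'(3) Q] .
  then interpret f: order_iso P Q f .
  have "finite (carrier Q)" using P'(2) f.image by simp
  moreover have "\<exists>R. obtained_by_interval_doublings R \<and> order_isomorphic Q R"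
    using P order_isomorphic_trans[OF order_isomorphic_sym[OF iso]]
    by (auto simp: doubling_lattice_def constructable_by_interval_doublings_def)
  ultimately show ?thesis
    using P f.lattice_image[OF P'(1)] f.semidistributive_image[OF P'(1)]
    by (simp add: doubling_lattice_def constructable_by_interval_doublings_def
        f.card_join_irreducibles_image[OF P'(1)] f.card_meet_irreducibles_image[OF P'(1)])
qed

lemma doubling_lattice_double:
  assumes P: "doubling_lattice k P" and ab: "a \<in> carrier P" "b \<in> carrier P" "a \<sqsubseteq>\<^bsub>P\<^esub> b"
  shows "doubling_lattice (Suc k) (doubling P \<lbrace>a..b\<rbrace>\<^bsub>P\<^esub>)"
proof -
  note P' = doubling_latticeD[OF P]
  interpret I: interval_doubling P a b
    using P' ab by (simp add: interval_doubling_def interval_doubling_axioms_def)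
  obtain R where R: "obtained_by_interval_doublings R" "order_isomorphic P R"
    using P by (auto simp: doubling_lattice_def constructable_by_interval_doublings_def)
  note R' = obtained_by_interval_doublings_partial_order[OF R(1)]
  obtain f where f: "order_iso P R f" using order_isomorphicE[OF R(2) P'(3) R'] .
  then interpret f: order_iso P R f .
  obtain S :: "nat gorder" where S: "partial_order S" "order_isomorphic I.D S"
    using order_isomorphic_nat_copy[OF I.partial_order_D I.finite_D[OF P'(2)]] .
  have "order_isomorphic (doubling R \<lbrace>f a..f b\<rbrace>\<^bsub>R\<^esub>) S"
    using order_isomorphic_sym[OF doubling_isomorphic[OF I.interval_doubling_axioms f]] S(2)
    by (rule order_isomorphic_trans)
  then have "obtained_by_interval_doublings S"
    using ab f.mono by (intro obtained_by_interval_doublings.double[OF R(1)] S(1)) auto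
  then show ?thesis
    using P P' S(2) I.lattice_D I.finite_D I.semidistributive_D I.card_irreducibles_D
    by (auto simp: doubling_lattice_def constructable_by_interval_doublings_def)
qed

lemma doubling_lattice_singleton:
  assumes "partial_order P" "carrier P = {p}"
  shows "doubling_lattice 0 P"
proof -
  interpret partial_order P by fact
  have [simp]: "p \<sqsubseteq>\<^bsub>P\<^esub> p" using assms by simp
  have lat: "lattice P" by (rule latticeI) (auto simp: assms)
  have [simp]: "p \<squnion>\<^bsub>P\<^esub> p = p" "p \<sqinter>\<^bsub>P\<^esub> p = p"
    by (rule join_equality meet_equality; simp add: assms)+
  have "semidistributive P"
    using lat by (simp add: semidistributive_def join_semidistributive_def
        meet_semidistributive_def assms(2))
  moreover obtain Q :: "nat gorder" where Q: "partial_order Q" "order_isomorphic P Q"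
    using order_isomorphic_nat_copy[OF assms(1)] assms(2) by auto
  then obtain f where "order_iso P Q f" using order_isomorphicE assms(1) by blast
  then have "carrier Q = {f p}"
    using order_iso.image assms(2) by fastforce
  with Q(1) have "obtained_by_interval_doublings Q"
    by (rule obtained_by_interval_doublings.one_element)
  moreover have "join_irreducibles P = {}" "meet_irreducibles P = {}"
    by (auto simp: join_irreducibles_def meet_irreducibles_def least_def greatest_def assms(2))
  ultimately show ?thesis
    using lat Q(2) by (auto simp: doubling_lattice_def constructable_by_interval_doublings_def assms(2))
qed

lemma doubling_lattice_step:
  fixes P :: "'a gorder" and Q :: "'b gorder" and f :: "'b \<Rightarrow> 'a"
  assumes P: "doubling_lattice k P" and ab: "a \<in> carrier P" "b \<in> carrier P" "a \<sqsubseteq>\<^bsub>P\<^esub> b"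
    and Q: "partial_order Q"
    and f: "\<And>x. x \<in> carrier Q \<Longrightarrow> f x \<in> carrier P"
    and le: "\<And>x y. x \<in> carrier Q \<Longrightarrow> y \<in> carrier Q \<Longrightarrow>
      x \<sqsubseteq>\<^bsub>Q\<^esub> y \<longleftrightarrow> f x \<sqsubseteq>\<^bsub>P\<^esub> f y \<and> (d x \<longrightarrow> d y)"
    and low: "\<And>p. p \<in> carrier P \<Longrightarrow> (\<exists>x\<in>carrier Q. f x = p \<and> \<not> d x) \<longleftrightarrow> p \<sqsubseteq>\<^bsub>P\<^esub> b"
    and high: "\<And>p. p \<in> carrier P \<Longrightarrow>
      (\<exists>x\<in>carrier Q. f x = p \<and> d x) \<longleftrightarrow> \<not> p \<sqsubseteq>\<^bsub>P\<^esub> b \<or> a \<sqsubseteq>\<^bsub>P\<^esub> p"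
  shows "doubling_lattice (Suc k) Q"
proof -
  note P' = doubling_latticeD[OF P]
  interpret I: interval_doubling P a b
    using P' ab by (simp add: interval_doubling_def interval_doubling_axioms_def)
  interpret Q: partial_order Q by fact
  let ?h = "\<lambda>x. (f x, if d x then 2 else 1 :: nat)"
  have "order_iso Q I.D ?h"
  proof (intro order_iso.intro Q I.partial_order_D order_iso_axioms.intro)
    show emb: "?h x \<sqsubseteq>\<^bsub>I.D\<^esub> ?h y \<longleftrightarrow> x \<sqsubseteq>\<^bsub>Q\<^esub> y" if "x \<in> carrier Q" "y \<in> carrier Q" for x y
      using that by (simp add: le I.le_D)
    show "bij_betw ?h (carrier Q) (carrier I.D)"
      unfolding bij_betw_def
    proof
      show "inj_on ?h (carrier Q)"
      proof (rule inj_onI)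
        fix x y assume xy: "x \<in> carrier Q" "y \<in> carrier Q" "?h x = ?h y"
        then have "x \<sqsubseteq>\<^bsub>Q\<^esub> y" "y \<sqsubseteq>\<^bsub>Q\<^esub> x"
          by (auto simp: le intro: f I.le_refl split: if_splits)
        with xy(1,2) show "x = y" by blast
      qed
      show "?h ` carrier Q = carrier I.D"
      proof (intro equalityI subsetI)
        fix z assume "z \<in> ?h ` carrier Q"
        then obtain x where x: "x \<in> carrier Q" "z = ?h x" by blast
        show "z \<in> carrier I.D"
          using x low[OF f[OF x(1)]] high[OF f[OF x(1)]] f[OF x(1)]
          by (auto simp: I.mem_carrier_D)
      next
        fix z assume z: "z \<in> carrier I.D"
        obtain p i where pi: "z = (p, i)" by fastforce
        have "p \<in> carrier P" using z by (auto simp: pi I.mem_carrier_D)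
        then obtain x where "x \<in> carrier Q" "f x = p" "i = (if d x then 2 else 1)"
          using z low[of p] high[of p] unfolding pi I.mem_carrier_D by metis
        then show "z \<in> ?h ` carrier Q" by (auto simp: pi)
      qed
    qed
  qed
  then have "order_isomorphic I.D Q"
    by (blast intro: order_iso.isomorphic order_isomorphic_sym)
  with doubling_lattice_double[OF P ab] Q show ?thesis
    by (blast intro: doubling_lattice_isomorphic)
qed

lemma poset_length_eqI:
  fixes P (structure)
  assumes "partial_order P"
    and strict: "\<And>x y. x \<in> carrier P \<Longrightarrow> y \<in> carrier P \<Longrightarrow> x \<sqsubseteq> y \<Longrightarrow> x \<noteq> y \<Longrightarrow> r x < (r y :: nat)"
    and bound: "\<And>x. x \<in> carrier P \<Longrightarrow> r x \<le> k"
    and chain: "\<And>i. i \<le> k \<Longrightarrow> c i \<in> carrier P \<and> r (c i) = i"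
      "\<And>i. i < k \<Longrightarrow> c i \<sqsubseteq> c (Suc i)"
  shows "poset_length P = k"
proof -
  interpret partial_order P by fact
  have less: "r x < r y" if "x \<sqsubset> y" "x \<in> carrier P" "y \<in> carrier P" for x y
    using that strict by (simp add: lless_def eq_is_equal)
  have "covered_by P (c i) (c (Suc i))" if "i < k" for i
  proof -
    have "c i \<noteq> c (Suc i)" using that chain(1)[of i] chain(1)[of "Suc i"] by auto
    then have "c i \<sqsubset> c (Suc i)"
      using chain(2)[OF that] by (simp add: lless_def eq_is_equal)
    moreover have False if "x \<in> carrier P" "c i \<sqsubset> x" "x \<sqsubset> c (Suc i)" for x
      using less[of "c i" x] less[of x "c (Suc i)"] that \<open>i < k\<close>
        chain(1)[of i] chain(1)[of "Suc i"] by auto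
    ultimately show ?thesis
      using that chain(1)[of i] chain(1)[of "Suc i"] by (auto simp: covered_by_def)
  qed
  moreover have "l \<le> k"
    if e: "\<forall>i\<le>l. e i \<in> carrier P" "\<forall>i<l. covered_by P (e i) (e (Suc i))" for l e
  proof -
    have "i \<le> r (e i)" if "i \<le> l" for i
      using that
    proof (induction i)
      case (Suc i)
      then have "r (e i) < r (e (Suc i))"
        using e less by (auto simp: covered_by_def)
      with Suc show ?case by simp
    qed simp
    from this[of l] show ?thesis using bound[of "e l"] e(1) by simp
  qed
  ultimately show ?thesis
    unfolding poset_length_def using chain(1)
    by (intro Max_eqI) (auto intro: finite_subset[of _ "{..k}"] exI[of _ c])
qed

section \<open>Codes of shuffle words\<close>

fun admissible :: "nat \<Rightarrow> nat set \<Rightarrow> nat list \<Rightarrow> bool" where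
  "admissible n B [] \<longleftrightarrow> True"
| "admissible n B (c # cs) \<longleftrightarrow>
    admissible n B cs \<and> (c = Suc n \<or> c \<in> insert 0 B \<and> (\<forall>e\<in>set cs. c \<le> e))"

text \<open>
  The first entry belongs to the first \<open>x\<close>-letter; the entries of letters that are present
  (those different from \<open>n + 1\<close>) increase weakly.
\<close>

definition Codes :: "nat \<Rightarrow> nat \<Rightarrow> (nat set \<times> nat list) set" where
  "Codes n m = {(B, cs). B \<subseteq> {1..n} \<and> length cs = m \<and> admissible n B cs}"

definition code_order :: "(nat set \<times> nat list) set \<Rightarrow> (nat set \<times> nat list) gorder" where
  "code_order A = \<lparr>carrier = A, eq = (=),
     le = (\<lambda>(B, cs) (B', cs'). B \<subseteq> B' \<and> list_all2 (\<le>) cs cs')\<rparr>"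

lemma carrier_code_order [simp]: "carrier (code_order A) = A"
  by (simp add: code_order_def)

lemma le_code_order [simp]:
  "(B, cs) \<sqsubseteq>\<^bsub>code_order A\<^esub> (B', cs') \<longleftrightarrow> B \<subseteq> B' \<and> list_all2 (\<le>) cs cs'"
  by (simp add: code_order_def)

lemma list_all2_le_antisym:
  fixes xs ys :: "'a :: order list"
  shows "list_all2 (\<le>) xs ys \<Longrightarrow> list_all2 (\<le>) ys xs \<Longrightarrow> xs = ys"
  by (induction rule: list_all2_induct) auto

lemma list_all2_le_trans:
  fixes xs ys :: "'a :: order list"
  shows "list_all2 (\<le>) xs ys \<Longrightarrow> list_all2 (\<le>) ys zs \<Longrightarrow> list_all2 (\<le>) xs zs"
  by (rule list_all2_trans[of "(\<le>)" "(\<le>)"]) auto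

lemma list_all2_le_refl [simp]:
  fixes xs :: "'a :: order list"
  shows "list_all2 (\<le>) xs xs"
  by (simp add: list.rel_refl)

lemma partial_order_code_order: "partial_order (code_order A)"
proof (rule partial_orderI)
  show "eq (code_order A) = (=)" by (simp add: code_order_def)
next
  fix x y z
  assume "x \<sqsubseteq>\<^bsub>code_order A\<^esub> y" "y \<sqsubseteq>\<^bsub>code_order A\<^esub> z"
  then show "x \<sqsubseteq>\<^bsub>code_order A\<^esub> z"
    by (cases x; cases y; cases z) (auto dest: list_all2_le_trans)
qed (auto dest: list_all2_le_antisym)

lemma list_all2_replicate_right:
  "list_all2 R xs (replicate k y) \<longleftrightarrow> length xs = k \<and> (\<forall>x\<in>set xs. R x y)"
  by (auto simp: list_all2_conv_all_nth all_set_conv_all_nth)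

lemma list_all2_replicate_left:
  "list_all2 R (replicate k x) ys \<longleftrightarrow> length ys = k \<and> (\<forall>y\<in>set ys. R x y)"
  by (auto simp: list_all2_conv_all_nth all_set_conv_all_nth)

lemma admissible_le:
  assumes "admissible n B cs" "B \<subseteq> {1..n}" "c \<in> set cs"
  shows "c \<le> Suc n"
  using assms by (induction cs) auto

lemma admissible_replicate: "c \<in> insert 0 B \<Longrightarrow> admissible n B (replicate m c)"
  by (induction m) auto

lemma admissible_replicate_Suc: "admissible n B (replicate m (Suc n))"
  by (induction m) auto

lemma Codes_bounds:
  assumes "(B, cs) \<in> Codes n m"
  shows "B \<subseteq> {1..n}" "length cs = m" "\<And>c. c \<in> set cs \<Longrightarrow> c \<le> Suc n"
  using assms admissible_le by (auto simp: Codes_def)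

text \<open>The image of \<open>Codes n (Suc m)\<close> when the first entry \<open>c\<close> is replaced by \<open>max c t\<close>.\<close>

definition Trunc :: "nat \<Rightarrow> nat \<Rightarrow> nat \<Rightarrow> (nat set \<times> nat list) set" where
  "Trunc n m t = {(B, c # cs) | B c cs. (B, cs) \<in> Codes n m \<and>
     (c = Suc n \<or> c = t \<or> t < c \<and> c \<in> B \<and> (\<forall>e\<in>set cs. c \<le> e))}"

lemma Trunc_0: "Trunc n m 0 = Codes n (Suc m)"
proof (intro equalityI subsetI)
  fix x assume "x \<in> Trunc n m 0"
  then show "x \<in> Codes n (Suc m)" by (auto simp: Trunc_def Codes_def)
next
  fix x assume "x \<in> Codes n (Suc m)"
  then obtain B c cs where "x = (B, c # cs)" "B \<subseteq> {1..n}" "length cs = m" "admissible n B (c # cs)"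
    by (auto simp: Codes_def length_Suc_conv)
  then show "x \<in> Trunc n m 0" by (auto simp: Trunc_def Codes_def)
qed

lemma mem_Trunc:
  "(B, cs') \<in> Trunc n m t \<longleftrightarrow> (\<exists>c cs. cs' = c # cs \<and> (B, cs) \<in> Codes n m \<and>
     (c = Suc n \<or> c = t \<or> t < c \<and> c \<in> B \<and> (\<forall>e\<in>set cs. c \<le> e)))"
  by (auto simp: Trunc_def)

lemma mem_Trunc_n:
  "(B, cs') \<in> Trunc n m n \<longleftrightarrow>
    (\<exists>c cs. cs' = c # cs \<and> (B, cs) \<in> Codes n m \<and> (c = n \<or> c = Suc n))"
  by (auto simp: mem_Trunc Codes_def)

lemma doubling_lattice_Codes_0: "doubling_lattice n (code_order (Codes n 0))"
proof (induction n)
  case 0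
  show ?case
    by (rule doubling_lattice_singleton[OF partial_order_code_order, of _ "({}, [])"])
      (auto simp: Codes_def)
next
  case (Suc n)
  have C: "(B, cs) \<in> Codes k 0 \<longleftrightarrow> B \<subseteq> {1..k} \<and> cs = []" for B cs k
    by (auto simp: Codes_def)
  show ?case
  proof (rule doubling_lattice_step[OF Suc, of "({}, [])" "({1..n}, [])" _
        "\<lambda>(B, cs). (B - {Suc n}, cs)" "\<lambda>(B, cs). Suc n \<in> B"])
    fix x assume "x \<in> carrier (code_order (Codes (Suc n) 0))"
    then show "(case x of (B, cs) \<Rightarrow> (B - {Suc n}, cs)) \<in> carrier (code_order (Codes n 0))"
      by (cases x) (auto simp: C less_Suc_eq_le[symmetric] subset_iff less_Suc_eq)
  next
    fix p assume p: "p \<in> carrier (code_order (Codes n 0))"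
    then obtain B where B: "p = (B, [])" "B \<subseteq> {1..n}" by (cases p) (auto simp: C)
    then have "Suc n \<notin> B" by auto
    then have "(B, []) \<in> Codes (Suc n) 0 \<and> B - {Suc n} = B \<and> Suc n \<notin> B"
      "(insert (Suc n) B, []) \<in> Codes (Suc n) 0 \<and> insert (Suc n) B - {Suc n} = B"
      using B(2) by (auto simp: C subset_iff)
    then show
      "(\<exists>x\<in>carrier (code_order (Codes (Suc n) 0)).
          (case x of (B, cs) \<Rightarrow> (B - {Suc n}, cs)) = p \<and> \<not> (case x of (B, cs) \<Rightarrow> Suc n \<in> B)) \<longleftrightarrow>
        p \<sqsubseteq>\<^bsub>code_order (Codes n 0)\<^esub> ({1..n}, [])"
      "(\<exists>x\<in>carrier (code_order (Codes (Suc n) 0)).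
          (case x of (B, cs) \<Rightarrow> (B - {Suc n}, cs)) = p \<and> (case x of (B, cs) \<Rightarrow> Suc n \<in> B)) \<longleftrightarrow>
        \<not> p \<sqsubseteq>\<^bsub>code_order (Codes n 0)\<^esub> ({1..n}, []) \<or> ({}, []) \<sqsubseteq>\<^bsub>code_order (Codes n 0)\<^esub> p"
      using B by (auto intro: bexI[of _ "(B, [])"] bexI[of _ "(insert (Suc n) B, [])"])
  qed (auto simp: C partial_order_code_order)
qed

lemma doubling_lattice_Trunc_n:
  assumes "doubling_lattice k (code_order (Codes n m))"
  shows "doubling_lattice (Suc k) (code_order (Trunc n m n))"
proof (rule doubling_lattice_step[OF assms, of "({}, replicate m 0)"
      "({1..n}, replicate m (Suc n))" _ "\<lambda>(B, cs). (B, tl cs)" "\<lambda>(B, cs). hd cs = Suc n"])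
  fix x assume "x \<in> carrier (code_order (Trunc n m n))"
  then show "(case x of (B, cs) \<Rightarrow> (B, tl cs)) \<in> carrier (code_order (Codes n m))"
    by (auto simp: Trunc_def)
next
  fix p assume p: "p \<in> carrier (code_order (Codes n m))"
  then obtain B cs where B: "p = (B, cs)" "(B, cs) \<in> Codes n m" by (cases p) auto
  note bounds = Codes_bounds[OF B(2)]
  have "(B, n # cs) \<in> Trunc n m n" "(B, Suc n # cs) \<in> Trunc n m n"
    using B by (auto simp: Trunc_def)
  moreover have "p \<sqsubseteq>\<^bsub>code_order (Codes n m)\<^esub> ({1..n}, replicate m (Suc n))"
    "({}, replicate m 0) \<sqsubseteq>\<^bsub>code_order (Codes n m)\<^esub> p"
    using B bounds by (auto simp: list_all2_replicate_right list_all2_replicate_left)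
  ultimately show
    "(\<exists>x\<in>carrier (code_order (Trunc n m n)).
        (case x of (B, cs) \<Rightarrow> (B, tl cs)) = p \<and> \<not> (case x of (B, cs) \<Rightarrow> hd cs = Suc n)) \<longleftrightarrow>
      p \<sqsubseteq>\<^bsub>code_order (Codes n m)\<^esub> ({1..n}, replicate m (Suc n))"
    "(\<exists>x\<in>carrier (code_order (Trunc n m n)).
        (case x of (B, cs) \<Rightarrow> (B, tl cs)) = p \<and> (case x of (B, cs) \<Rightarrow> hd cs = Suc n)) \<longleftrightarrow>
      \<not> p \<sqsubseteq>\<^bsub>code_order (Codes n m)\<^esub> ({1..n}, replicate m (Suc n)) \<or>
      ({}, replicate m 0) \<sqsubseteq>\<^bsub>code_order (Codes n m)\<^esub> p"
    using B(1) by (auto intro: bexI[of _ "(B, n # cs)"] bexI[of _ "(B, Suc n # cs)"])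
next
  fix x y assume "x \<in> carrier (code_order (Trunc n m n))" "y \<in> carrier (code_order (Trunc n m n))"
  then show "x \<sqsubseteq>\<^bsub>code_order (Trunc n m n)\<^esub> y \<longleftrightarrow>
      (case x of (B, cs) \<Rightarrow> (B, tl cs)) \<sqsubseteq>\<^bsub>code_order (Codes n m)\<^esub> (case y of (B, cs) \<Rightarrow> (B, tl cs)) \<and>
      ((case x of (B, cs) \<Rightarrow> hd cs = Suc n) \<longrightarrow> (case y of (B, cs) \<Rightarrow> hd cs = Suc n))"
    by (cases x; cases y) (auto simp: mem_Trunc_n)
qed (auto simp: Codes_def partial_order_code_order admissible_replicate admissible_replicate_Suc
    list_all2_replicate_left)

lemma doubling_lattice_Trunc_Suc:
  assumes "doubling_lattice k (code_order (Trunc n m (Suc t)))" and t: "Suc t \<le> n"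
  shows "doubling_lattice (Suc k) (code_order (Trunc n m t))"
proof -
  define f :: "nat set \<times> nat list \<Rightarrow> nat set \<times> nat list"
    where "f = (\<lambda>(B, cs). (B, max (hd cs) (Suc t) # tl cs))"
  define d :: "nat set \<times> nat list \<Rightarrow> bool" where "d = (\<lambda>(B, cs). t < hd cs)"
  let ?P = "code_order (Trunc n m (Suc t))" and ?Q = "code_order (Trunc n m t)"
  let ?a = "({Suc t}, replicate (Suc m) (Suc t))" and ?b = "({1..n}, Suc t # replicate m (Suc n))"
  have f: "f (B, c # cs) = (B, max c (Suc t) # cs)" and d: "d (B, c # cs) \<longleftrightarrow> t < c" for B c cs
    by (simp_all add: f_def d_def)
  show ?thesis
  proof (rule doubling_lattice_step[OF assms(1), of ?a ?b ?Q f d])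
    show "?a \<in> carrier ?P" "?b \<in> carrier ?P" "?a \<sqsubseteq>\<^bsub>?P\<^esub> ?b"
      using t by (auto simp: Trunc_def Codes_def admissible_replicate admissible_replicate_Suc
          list_all2_replicate_left)
    show "partial_order ?Q" by (rule partial_order_code_order)
  next
    fix x assume "x \<in> carrier ?Q"
    then show "f x \<in> carrier ?P"
      using t by (cases x) (auto simp: mem_Trunc f max_def)
  next
    fix x y assume "x \<in> carrier ?Q" "y \<in> carrier ?Q"
    then show "x \<sqsubseteq>\<^bsub>?Q\<^esub> y \<longleftrightarrow> f x \<sqsubseteq>\<^bsub>?P\<^esub> f y \<and> (d x \<longrightarrow> d y)"
      using t by (cases x; cases y) (auto simp: mem_Trunc f d max_def split: if_splits)
  next
    fix p assume p: "p \<in> carrier ?P"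
    then obtain B e cs where B: "p = (B, e # cs)" "(B, cs) \<in> Codes n m"
      and e: "e = Suc n \<or> e = Suc t \<or> Suc t < e \<and> e \<in> B \<and> (\<forall>c\<in>set cs. e \<le> c)"
      by (cases p) (auto simp: mem_Trunc)
    note bounds = Codes_bounds[OF B(2)]
    have pb: "p \<sqsubseteq>\<^bsub>?P\<^esub> ?b \<longleftrightarrow> e = Suc t"
      using B bounds e t by (auto simp: list_all2_replicate_right)
    have ap: "?a \<sqsubseteq>\<^bsub>?P\<^esub> p \<longleftrightarrow> Suc t \<in> B \<and> (\<forall>c\<in>set cs. Suc t \<le> c)"
      using B bounds e t by (auto simp: list_all2_replicate_left)
    have fp: "(\<exists>x\<in>carrier ?Q. f x = p \<and> Q (d x)) \<longleftrightarrow>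
        (\<exists>c. (B, c # cs) \<in> Trunc n m t \<and> max c (Suc t) = e \<and> Q (t < c))" (is "?L \<longleftrightarrow> ?R") for Q
    proof
      assume ?L
      then obtain x where x: "x \<in> Trunc n m t" "f x = p" "Q (d x)" by auto
      then obtain c where "x = (B, c # cs)" "max c (Suc t) = e"
        by (cases x) (auto simp: mem_Trunc f B(1))
      with x show ?R by (auto simp: d)
    next
      assume ?R
      then obtain c where "(B, c # cs) \<in> Trunc n m t" "max c (Suc t) = e" "Q (t < c)" by blast
      then show ?L by (intro bexI[of _ "(B, c # cs)"]) (simp_all add: f d B(1))
    qed
    show "(\<exists>x\<in>carrier ?Q. f x = p \<and> \<not> d x) \<longleftrightarrow> p \<sqsubseteq>\<^bsub>?P\<^esub> ?b"
      unfolding fp[of Not] pb using B(2) t by (auto simp: mem_Trunc intro!: exI[of _ t])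
    have "max c (Suc t) = e \<and> t < c \<longleftrightarrow> c = e" for c
      using e t by auto
    moreover have "(B, e # cs) \<in> Trunc n m t \<longleftrightarrow>
        e \<noteq> Suc t \<or> Suc t \<in> B \<and> (\<forall>c\<in>set cs. Suc t \<le> c)"
      using B(2) e t by (cases "e = Suc t") (auto simp: mem_Trunc)
    ultimately show "(\<exists>x\<in>carrier ?Q. f x = p \<and> d x) \<longleftrightarrow> \<not> p \<sqsubseteq>\<^bsub>?P\<^esub> ?b \<or> ?a \<sqsubseteq>\<^bsub>?P\<^esub> p"
      unfolding fp[of "\<lambda>x. x"] pb ap by simp
  qed
qed

lemma doubling_lattice_Codes: "doubling_lattice (n + m * Suc n) (code_order (Codes n m))"
proof (induction m)
  case 0
  then show ?case using doubling_lattice_Codes_0 by simp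
next
  case (Suc m)
  have "doubling_lattice (n + m * Suc n + Suc i) (code_order (Trunc n m (n - i)))" if "i \<le> n" for i
    using that
  proof (induction i)
    case 0
    then show ?case using doubling_lattice_Trunc_n[OF Suc.IH] by simp
  next
    case (Suc i)
    then have "Suc (n - Suc i) = n - i" by simp
    then show ?case
      using doubling_lattice_Trunc_Suc[of "n + m * Suc n + Suc i" n m "n - Suc i"] Suc by simp
  qed
  from this[of n] show ?case by (simp add: Trunc_0 algebra_simps)
qed

section \<open>The length\<close>

definition code_rank :: "nat set \<times> nat list \<Rightarrow> nat" where
  "code_rank = (\<lambda>(B, cs). card B + sum_list cs)"

lemma sum_list_mono_strict:
  fixes cs cs' :: "nat list"
  assumes "list_all2 (\<le>) cs cs'"
  shows "sum_list cs \<le> sum_list cs'" "cs \<noteq> cs' \<Longrightarrow> sum_list cs < sum_list cs'"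
proof -
  have "sum_list cs \<le> sum_list cs' \<and> (cs \<noteq> cs' \<longrightarrow> sum_list cs < sum_list cs')"
    using assms by (induction rule: list_all2_induct) auto
  then show "sum_list cs \<le> sum_list cs'" "cs \<noteq> cs' \<Longrightarrow> sum_list cs < sum_list cs'" by auto
qed

lemma maximal_chain_Codes:
  "\<exists>c. (\<forall>i \<le> n + m * Suc n. c i \<in> Codes n m \<and> code_rank (c i) = i) \<and>
    (\<forall>i < n + m * Suc n. c i \<sqsubseteq>\<^bsub>code_order (Codes n m)\<^esub> c (Suc i)) \<and>
    c (n + m * Suc n) = ({1..n}, replicate m (Suc n))"
proof (induction m)
  case 0
  show ?case
    by (rule exI[of _ "\<lambda>i. ({1..i}, [])"]) (auto simp: Codes_def code_rank_def)
next
  case (Suc m)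
  define N where "N = n + m * Suc n"
  obtain c where c: "\<And>i. i \<le> N \<Longrightarrow> c i \<in> Codes n m" "\<And>i. i \<le> N \<Longrightarrow> code_rank (c i) = i"
    "\<And>i. i < N \<Longrightarrow> c i \<sqsubseteq>\<^bsub>code_order (Codes n m)\<^esub> c (Suc i)" "c N = ({1..n}, replicate m (Suc n))"
    using Suc.IH unfolding N_def by blast
  define e where "e i = (if i \<le> N then (fst (c i), 0 # snd (c i))
    else ({1..n}, (i - N) # replicate m (Suc n)))" for i
  have M: "n + Suc m * Suc n = N + Suc n" by (simp add: N_def)
  have "e i \<in> Codes n (Suc m) \<and> code_rank (e i) = i" if "i \<le> N + Suc n" for i
  proof (cases "i \<le> N")
    case True
    then show ?thesis
      using c(1,2)[OF True] by (cases "c i") (auto simp: e_def Codes_def code_rank_def)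
  next
    case False
    have "code_rank (c N) = N" using c(2) by simp
    then show ?thesis
      using False that c(4)
      by (auto simp: e_def Codes_def code_rank_def admissible_replicate_Suc)
  qed
  moreover have "e i \<sqsubseteq>\<^bsub>code_order (Codes n (Suc m))\<^esub> e (Suc i)" if "i < N + Suc n" for i
  proof (cases "i < N")
    case True
    then show ?thesis
      using c(3)[OF True] by (cases "c i"; cases "c (Suc i)") (auto simp: e_def)
  next
    case False
    then show ?thesis using c(4) by (cases "i = N") (auto simp: e_def)
  qed
  moreover have "e (N + Suc n) = ({1..n}, replicate (Suc m) (Suc n))"
    by (simp add: e_def)
  ultimately show ?case unfolding M by blast
qed

lemma poset_length_Codes: "poset_length (code_order (Codes n m)) = n + m * Suc n"
proof -
  obtain c where c: "\<And>i. i \<le> n + m * Suc n \<Longrightarrow> c i \<in> Codes n m \<and> code_rank (c i) = i"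
    "\<And>i. i < n + m * Suc n \<Longrightarrow> c i \<sqsubseteq>\<^bsub>code_order (Codes n m)\<^esub> c (Suc i)"
    using maximal_chain_Codes by blast
  show ?thesis
  proof (rule poset_length_eqI[OF partial_order_code_order, of _ code_rank _ c])
    fix x y assume xy: "x \<in> carrier (code_order (Codes n m))" "y \<in> carrier (code_order (Codes n m))"
      "x \<sqsubseteq>\<^bsub>code_order (Codes n m)\<^esub> y" "x \<noteq> y"
    obtain B cs B' cs' where [simp]: "x = (B, cs)" "y = (B', cs')" by fastforce
    have fin: "finite B'"
      using xy(2) Codes_bounds(1)[of B' cs' n m] by (auto intro: finite_subset)
    have sub: "B \<subseteq> B'" "list_all2 (\<le>) cs cs'" using xy by auto
    have "card B \<le> card B'" "B \<noteq> B' \<Longrightarrow> card B < card B'"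
      using sub(1) fin by (auto intro: card_mono psubset_card_mono)
    then show "code_rank x < code_rank y"
      using sum_list_mono_strict[OF sub(2)] xy(4) by (cases "B = B'") (auto simp: code_rank_def)
  next
    fix x assume "x \<in> carrier (code_order (Codes n m))"
    then obtain B cs where x: "x = (B, cs)" "(B, cs) \<in> Codes n m" by (cases x) auto
    note bounds = Codes_bounds[OF x(2)]
    have "card B \<le> n" using card_mono[OF _ bounds(1)] by simp
    moreover have "sum_list cs \<le> m * Suc n"
      using sum_list_mono_strict(1)[of cs "replicate m (Suc n)"] bounds(2,3)
      by (simp add: list_all2_replicate_right sum_list_replicate)
    ultimately show "code_rank x \<le> n + m * Suc n"
      by (simp add: code_rank_def x)
  qed (use c in auto)
qed

section \<open>Shuffle words\<close>

fun letters_ok :: "letter \<Rightarrow> letter \<Rightarrow> bool" where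
  "letters_ok (LX i) (LX j) \<longleftrightarrow> i < j"
| "letters_ok (LY i) (LY j) \<longleftrightarrow> i < j"
| "letters_ok _ _ \<longleftrightarrow> True"

lemma set_xword: "set (xword m) = LX ` {1..m}" and set_yword: "set (yword n) = LY ` {1..n}"
  by (auto simp: xword_def yword_def)

lemma subseq_sorted_wrt:
  assumes "subseq xs ys" "sorted_wrt R ys"
  shows "sorted_wrt R xs"
  using assms by induction (auto dest: list_emb_set)

lemma sorted_letters_ok_distinct: "sorted_wrt letters_ok u \<Longrightarrow> distinct u"
proof (induction u)
  case (Cons a u)
  have "\<not> letters_ok a a" by (cases a) auto
  with Cons show ?case by auto
qed simp

lemma sorted_letters_ok_split:
  assumes "sorted_wrt letters_ok (filter (\<lambda>a. a \<in> LX ` S) u)"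
    "sorted_wrt letters_ok (filter (\<lambda>a. a \<in> LY ` T) u)" "set u \<subseteq> LX ` S \<union> LY ` T"
  shows "sorted_wrt letters_ok u"
  using assms
proof (induction u)
  case (Cons a u)
  have "letters_ok a b" if "b \<in> set u" for b
    using Cons.prems that by (cases a; cases b) (fastforce split: if_splits)+
  moreover have "sorted_wrt letters_ok u"
    using Cons by (auto split: if_splits)
  ultimately show ?case by simp
qed simp

lemma subseq_xword:
  assumes "sorted_wrt letters_ok v" "set v \<subseteq> set (xword m)"
  shows "subseq v (xword m)"
proof -
  obtain ks where v: "v = map LX ks"
    using assms(2) unfolding set_xword
    by (metis (no_types, lifting) ex_map_conv image_iff subsetD)
  have "sorted_wrt (<) ks" "set ks \<subseteq> set [1..<Suc m]"
    using assms by (auto simp: v sorted_wrt_map set_xword)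
  then have "subseq ks [1..<Suc m]"
    by (intro sorted_subset_imp_subseq) (auto simp del: upt_Suc)
  then show ?thesis unfolding v xword_def by (rule subseq_map)
qed

lemma subseq_yword:
  assumes "sorted_wrt letters_ok v" "set v \<subseteq> set (yword n)"
  shows "subseq v (yword n)"
proof -
  obtain ks where v: "v = map LY ks"
    using assms(2) unfolding set_yword
    by (metis (no_types, lifting) ex_map_conv image_iff subsetD)
  have "sorted_wrt (<) ks" "set ks \<subseteq> set [1..<Suc n]"
    using assms by (auto simp: v sorted_wrt_map set_yword)
  then have "subseq ks [1..<Suc n]"
    by (intro sorted_subset_imp_subseq) (auto simp del: upt_Suc)
  then show ?thesis unfolding v yword_def by (rule subseq_map)
qed

lemma Shuf_iff:
  "u \<in> Shuf m n \<longleftrightarrow> set u \<subseteq> LX ` {1..m} \<union> LY ` {1..n} \<and> sorted_wrt letters_ok u"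
proof
  assume u: "u \<in> Shuf m n"
  have "sorted_wrt letters_ok (xword m)" "sorted_wrt letters_ok (yword n)"
    unfolding xword_def yword_def sorted_wrt_map by (simp_all del: upt_Suc)
  then have "sorted_wrt letters_ok (restriction u (xword m))"
    "sorted_wrt letters_ok (restriction u (yword n))"
    using u by (auto simp: Shuf_def intro: subseq_sorted_wrt)
  then show "set u \<subseteq> LX ` {1..m} \<union> LY ` {1..n} \<and> sorted_wrt letters_ok u"
    using u unfolding restriction_def set_xword set_yword
    by (auto simp: Shuf_def set_xword set_yword intro: sorted_letters_ok_split)
next
  assume u: "set u \<subseteq> LX ` {1..m} \<union> LY ` {1..n} \<and> sorted_wrt letters_ok u"
  then show "u \<in> Shuf m n"
    by (auto simp: Shuf_def sorted_letters_ok_distinct restriction_def set_xword set_yword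
        intro!: subseq_xword subseq_yword sorted_wrt_filter)
qed

lemma Shuf_distinct: "u \<in> Shuf m n \<Longrightarrow> distinct u"
  by (simp add: Shuf_def)

fun before :: "'a \<Rightarrow> 'a \<Rightarrow> 'a list \<Rightarrow> bool" where
  "before a b [] \<longleftrightarrow> False"
| "before a b (c # u) \<longleftrightarrow> c = a \<and> b \<in> set u \<or> before a b u"

lemma before_append:
  "before a b (u @ v) \<longleftrightarrow> before a b u \<or> a \<in> set u \<and> b \<in> set v \<or> before a b v"
  by (induction u) auto

lemma before_set: "before a b u \<Longrightarrow> a \<in> set u \<and> b \<in> set u"
  by (induction u) auto

lemma before_trans: "before a b u \<Longrightarrow> before b c u \<Longrightarrow> distinct u \<Longrightarrow> before a c u"
  by (induction u) (auto dest: before_set)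

lemma before_antisym: "before a b u \<Longrightarrow> distinct u \<Longrightarrow> \<not> before b a u"
  by (induction u) (auto dest: before_set)

lemma before_total: "a \<in> set u \<Longrightarrow> b \<in> set u \<Longrightarrow> a \<noteq> b \<Longrightarrow> before a b u \<or> before b a u"
  by (induction u) auto

lemma before_sorted_wrt: "before a b u \<Longrightarrow> sorted_wrt R u \<Longrightarrow> R a b"
  by (induction u) auto

lemma before_filter: "before a b (filter P u) \<longleftrightarrow> P a \<and> P b \<and> before a b u"
  by (induction u) (auto dest: before_set)

definition word_le :: "word \<Rightarrow> word \<Rightarrow> bool" where
  "word_le u v \<longleftrightarrow> (\<forall>s. LX s \<in> set v \<longrightarrow> LX s \<in> set u) \<and> (\<forall>t. LY t \<in> set u \<longrightarrow> LY t \<in> set v) \<and>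
    (\<forall>s t. LX s \<in> set v \<longrightarrow> before (LY t) (LX s) u \<longrightarrow> before (LY t) (LX s) v)"

lemma word_le_refl: "word_le u u"
  by (simp add: word_le_def)

lemma word_le_trans: "word_le u v \<Longrightarrow> word_le v w \<Longrightarrow> word_le u w"
  by (simp add: word_le_def)

lemma indel_iff:
  "indel m n u v \<longleftrightarrow> u \<in> Shuf m n \<and> v \<in> Shuf m n \<and>
    ((\<exists>p s q. u = p @ LX s # q \<and> v = p @ q) \<or> (\<exists>p t q. v = p @ LY t # q \<and> u = p @ q))"
    (is "?L \<longleftrightarrow> ?R")
proof
  have split: "u = take i u @ u ! i # drop (Suc i) u" if "i < length u" for u :: word and i
    using that by (rule id_take_nth_drop)
  assume L: ?L
  then consider i where "i < length u" "u ! i \<in> set (xword m)" "v = delete_at i u"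
    | i where "i < length v" "v ! i \<in> set (yword n)" "u = delete_at i v"
    unfolding indel_def by blast
  then show ?R
  proof cases
    case 1
    then obtain s where "u ! i = LX s" by (auto simp: set_xword)
    with split[of i u] 1 L show ?thesis unfolding delete_at_def indel_def by metis
  next
    case 2
    then obtain t where "v ! i = LY t" by (auto simp: set_yword)
    with split[of i v] 2 L show ?thesis unfolding delete_at_def indel_def by metis
  qed
next
  assume R: ?R
  then consider p s q where "u = p @ LX s # q" "v = p @ q" | p t q where "v = p @ LY t # q" "u = p @ q"
    by blast
  then show ?L
  proof cases
    case 1
    then have "LX s \<in> set (xword m)" using R by (auto simp: Shuf_iff set_xword)
    then have "length p < length u \<and> u ! length p \<in> set (xword m) \<and> v = delete_at (length p) u"
      using 1 by (simp add: delete_at_def)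
    then show ?thesis using R unfolding indel_def by blast
  next
    case 2
    then have "LY t \<in> set (yword n)" using R by (auto simp: Shuf_iff set_yword)
    then have "length p < length v \<and> v ! length p \<in> set (yword n) \<and> u = delete_at (length p) v"
      using 2 by (simp add: delete_at_def)
    then show ?thesis using R unfolding indel_def by blast
  qed
qed

lemma transposition_iff:
  "transposition m n u v \<longleftrightarrow> u \<in> Shuf m n \<and> v \<in> Shuf m n \<and>
    (\<exists>p s t q. u = p @ LX s # LY t # q \<and> v = p @ LY t # LX s # q)" (is "?L \<longleftrightarrow> ?R")
proof
  assume L: ?L
  then obtain i where i: "Suc i < length u" "u ! i \<in> set (xword m)" "u ! Suc i \<in> set (yword n)"
    "v = u[i := u ! Suc i, Suc i := u ! i]"
    unfolding transposition_def by blast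
  then obtain s t where st: "u ! i = LX s" "u ! Suc i = LY t"
    by (auto simp: set_xword set_yword)
  define p q where "p = take i u" and "q = drop (Suc (Suc i)) u"
  have u: "u = p @ LX s # LY t # q"
    using i(1) st by (metis Cons_nth_drop_Suc Suc_lessD append_take_drop_id p_def q_def)
  have "length p = i" using i(1) by (simp add: p_def)
  then have "v = p @ LY t # LX s # q"
    using i(4) st by (simp add: u list_update_append)
  with u L show ?R unfolding transposition_def by blast
next
  assume R: ?R
  then obtain p s t q where pq: "u = p @ LX s # LY t # q" "v = p @ LY t # LX s # q" by blast
  have "Suc (length p) < length u \<and> u ! length p \<in> set (xword m) \<and>
      u ! Suc (length p) \<in> set (yword n) \<and>
      v = u[length p := u ! Suc (length p), Suc (length p) := u ! length p]"
    using R by (auto simp: pq Shuf_iff set_xword set_yword list_update_append nth_append)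
  then show ?L using R unfolding transposition_def by blast
qed

lemma bubble_le_word_le: "bubble_le m n u v \<Longrightarrow> word_le u v"
  unfolding bubble_le_def
proof (induction rule: rtranclp_induct)
  case base
  show ?case by (rule word_le_refl)
next
  case (step v w)
  have "distinct v" "distinct w"
    using step.hyps(2) by (auto simp: indel_def transposition_def Shuf_def)
  then have "word_le v w"
    using step.hyps(2) unfolding indel_iff transposition_iff
    by (auto simp: word_le_def before_append)
  with step.IH show ?case by (rule word_le_trans)
qed

lemma bubble_le_trans: "bubble_le m n u v \<Longrightarrow> bubble_le m n v w \<Longrightarrow> bubble_le m n u w"
  unfolding bubble_le_def by (rule rtranclp_trans)

lemma bubble_le_refl: "bubble_le m n u u"
  by (simp add: bubble_le_def)

lemma Shuf_remove: "p @ a # q \<in> Shuf m n \<Longrightarrow> p @ q \<in> Shuf m n"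
  by (auto simp: Shuf_iff sorted_wrt_append)

lemma bubble_le_delete:
  assumes "p @ LX s # q \<in> Shuf m n"
  shows "bubble_le m n (p @ LX s # q) (p @ q)"
proof -
  have "indel m n (p @ LX s # q) (p @ q)"
    unfolding indel_iff using assms Shuf_remove[OF assms] by blast
  then show ?thesis by (auto simp: bubble_le_def)
qed

lemma bubble_le_insert:
  assumes "p @ LY t # q \<in> Shuf m n"
  shows "bubble_le m n (p @ q) (p @ LY t # q)"
proof -
  have "indel m n (p @ q) (p @ LY t # q)"
    unfolding indel_iff using assms Shuf_remove[OF assms] by blast
  then show ?thesis by (auto simp: bubble_le_def)
qed

lemma bubble_le_swap:
  assumes "p @ LX s # LY t # q \<in> Shuf m n"
  shows "bubble_le m n (p @ LX s # LY t # q) (p @ LY t # LX s # q)"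
proof -
  have "p @ LY t # LX s # q \<in> Shuf m n"
    using assms by (auto simp: Shuf_iff sorted_wrt_append)
  then have "transposition m n (p @ LX s # LY t # q) (p @ LY t # LX s # q)"
    unfolding transposition_iff using assms by blast
  then show ?thesis by (auto simp: bubble_le_def)
qed

lemma bubble_le_filter_X:
  assumes "p @ u \<in> Shuf m n" "\<And>t. LY t \<in> set u \<Longrightarrow> P (LY t)"
  shows "bubble_le m n (p @ u) (p @ filter P u)"
  using assms
proof (induction u arbitrary: p)
  case (Cons a u)
  show ?case
  proof (cases "P a")
    case True
    then show ?thesis using Cons.IH[of "p @ [a]"] Cons.prems by simp
  next
    case False
    then obtain s where a: "a = LX s" using Cons.prems(2) by (cases a) auto
    have "bubble_le m n (p @ a # u) (p @ u)"
      using bubble_le_delete Cons.prems(1) unfolding a by blast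
    moreover have "bubble_le m n (p @ u) (p @ filter P u)"
      using Cons.IH[of p] Cons.prems Shuf_remove by auto
    ultimately show ?thesis using False by (auto intro: bubble_le_trans)
  qed
qed (simp add: bubble_le_refl)

lemma bubble_le_filter_Y:
  assumes "p @ u \<in> Shuf m n" "\<And>s. LX s \<in> set u \<Longrightarrow> P (LX s)"
  shows "bubble_le m n (p @ filter P u) (p @ u)"
  using assms
proof (induction u arbitrary: p)
  case (Cons a u)
  show ?case
  proof (cases "P a")
    case True
    then show ?thesis using Cons.IH[of "p @ [a]"] Cons.prems by simp
  next
    case False
    then obtain t where a: "a = LY t" using Cons.prems(2) by (cases a) auto
    have "bubble_le m n (p @ u) (p @ a # u)"
      using bubble_le_insert Cons.prems(1) unfolding a by blast
    moreover have "bubble_le m n (p @ filter P u) (p @ u)"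
      using Cons.IH[of p] Cons.prems Shuf_remove by auto
    ultimately show ?thesis using False by (auto intro: bubble_le_trans)
  qed
qed (simp add: bubble_le_refl)

lemma bubble_le_slide:
  assumes "p @ xs @ LY t # q \<in> Shuf m n" "\<And>t'. LY t' \<notin> set xs"
  shows "bubble_le m n (p @ xs @ LY t # q) (p @ LY t # xs @ q) \<and> p @ LY t # xs @ q \<in> Shuf m n"
  using assms
proof (induction xs arbitrary: p)
  case (Cons a xs)
  obtain s where a: "a = LX s" using Cons.prems(2)[of "case a of LY t \<Rightarrow> t"] by (cases a) auto
  have IH: "bubble_le m n ((p @ [a]) @ xs @ LY t # q) ((p @ [a]) @ LY t # xs @ q)"
    "(p @ [a]) @ LY t # xs @ q \<in> Shuf m n"
    using Cons.IH[of "p @ [a]"] Cons.prems by auto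
  have "bubble_le m n (p @ LX s # LY t # xs @ q) (p @ LY t # LX s # xs @ q)"
    using IH(2) by (intro bubble_le_swap) (simp add: a)
  moreover have "p @ LY t # LX s # xs @ q \<in> Shuf m n"
    using IH(2) by (auto simp: a Shuf_iff sorted_wrt_append)
  ultimately show ?case
    using IH(1) bubble_le_trans[of m n "p @ LX s # xs @ LY t # q"] by (auto simp: a)
qed (simp add: bubble_le_refl)

lemma bubble_le_same_letters:
  assumes "p @ u \<in> Shuf m n" "p @ v \<in> Shuf m n" "set u = set v"
    "\<And>s t. before (LY t) (LX s) u \<Longrightarrow> before (LY t) (LX s) v"
  shows "bubble_le m n (p @ u) (p @ v)"
  using assms
proof (induction v arbitrary: u p)
  case Nil
  then show ?case by (simp add: bubble_le_refl)
next
  case (Cons d z)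
  have ok: "sorted_wrt letters_ok u" "sorted_wrt letters_ok (d # z)"
    using Cons.prems(1,2) by (auto simp: Shuf_iff sorted_wrt_append)
  note dist = this[THEN sorted_letters_ok_distinct]
  show ?case
  proof (cases d)
    case (LX s)
    obtain c w where u: "u = c # w" using Cons.prems(3) by (cases u) auto
    have cd: "c = d"
    proof (rule ccontr)
      assume "c \<noteq> d"
      then have in_sets: "c \<in> set z" "d \<in> set w" using Cons.prems(3) u by auto
      then have "letters_ok c d" "letters_ok d c" using ok u by auto
      then show False
        using Cons.prems(4)[of "case c of LY t \<Rightarrow> t" s] in_sets dist
        by (cases c) (auto simp: LX u dest: before_set)
    qed
    have "set w = set z" using Cons.prems(3) dist u cd by auto
    moreover have "before (LY t) (LX s') z" if "before (LY t) (LX s') w" for s' t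
      using Cons.prems(4)[of t s'] that by (auto simp: u cd LX)
    ultimately show ?thesis
      using Cons.IH[of "p @ [d]" w] Cons.prems(1,2) by (simp add: u cd)
  next
    case (LY t)
    obtain xs w where u: "u = xs @ LY t # w"
      using Cons.prems(3) LY by (metis list.set_intros(1) split_list)
    have xs: "LY t' \<notin> set xs" for t'
    proof
      assume t': "LY t' \<in> set xs"
      then have "t' < t" using ok(1) by (auto simp: u sorted_wrt_append)
      moreover have "LY t' \<in> set z" using t' \<open>t' < t\<close> Cons.prems(3) by (auto simp: u LY)
      then have "t < t'" using ok(2) by (auto simp: LY)
      ultimately show False by simp
    qed
    have slide: "bubble_le m n (p @ u) (p @ LY t # xs @ w)" "p @ LY t # xs @ w \<in> Shuf m n"
      using bubble_le_slide[of p xs t w m n] Cons.prems(1) xs by (auto simp: u)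
    have "set (xs @ w) = set z"
      using Cons.prems(3) dist insert_ident[of "LY t" "set (xs @ w)" "set z"] by (auto simp: u LY)
    moreover have "before (LY t') (LX s) z" if b: "before (LY t') (LX s) (xs @ w)" for s t'
    proof -
      have "t' \<noteq> t" using before_set[OF b] dist by (auto simp: u)
      moreover have "before (LY t') (LX s) u" using b by (auto simp: u before_append)
      ultimately show ?thesis using Cons.prems(4) by (fastforce simp: LY)
    qed
    ultimately have "bubble_le m n ((p @ [d]) @ xs @ w) ((p @ [d]) @ z)"
      using Cons.IH[of "p @ [d]" "xs @ w"] Cons.prems(2) slide(2) by (simp add: LY)
    then show ?thesis using bubble_le_trans[OF slide(1)] by (simp add: LY)
  qed
qed

lemma bubble_le_iff:
  assumes u: "u \<in> Shuf m n" and v: "v \<in> Shuf m n"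
  shows "bubble_le m n u v \<longleftrightarrow> word_le u v"
proof
  assume le: "word_le u v"
  define u' where "u' = filter (\<lambda>a. \<forall>s. a = LX s \<longrightarrow> a \<in> set v) u"
  define v' where "v' = filter (\<lambda>a. \<forall>t. a = LY t \<longrightarrow> a \<in> set u) v"
  have "bubble_le m n u u'"
    using bubble_le_filter_X[of "[]" u] u by (simp add: u'_def)
  moreover have "bubble_le m n v' v"
    using bubble_le_filter_Y[of "[]" v] v by (simp add: v'_def)
  moreover have "bubble_le m n ([] @ u') ([] @ v')"
  proof (rule bubble_le_same_letters)
    show "[] @ u' \<in> Shuf m n" "[] @ v' \<in> Shuf m n"
      using u v by (auto simp: Shuf_iff u'_def v'_def sorted_wrt_filter)
    have "a \<in> set u' \<longleftrightarrow> a \<in> set v'" for a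
      using le by (cases a) (auto simp: word_le_def u'_def v'_def)
    then show "set u' = set v'" by blast
    show "before (LY t) (LX s) v'" if "before (LY t) (LX s) u'" for s t
      using that le by (auto simp: word_le_def u'_def v'_def before_filter dest: before_set)
  qed
  ultimately show "bubble_le m n u v"
    by (metis append_Nil bubble_le_trans)
qed (rule bubble_le_word_le)

lemma words_eqI:
  assumes "sorted_wrt letters_ok u" "sorted_wrt letters_ok v" "set u = set v"
    "\<And>s t. before (LY t) (LX s) u \<longleftrightarrow> before (LY t) (LX s) v"
  shows "u = v"
  using assms
proof (induction v arbitrary: u)
  case (Cons d z)
  note dist = Cons.prems(1,2)[THEN sorted_letters_ok_distinct]
  obtain c w where u: "u = c # w" using Cons.prems(3) by (cases u) auto
  have cd: "c = d"
  proof (rule ccontr)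
    assume "c \<noteq> d"
    then have in_sets: "c \<in> set z" "d \<in> set w" using Cons.prems(3) u by auto
    then have "letters_ok c d" "letters_ok d c" using Cons.prems(1,2) u by auto
    then show False
      using Cons.prems(4) in_sets dist
      by (cases c; cases d) (fastforce simp: u dest: before_set)+
  qed
  have sets: "set w = set z" using Cons.prems(3) dist u cd by auto
  have "before (LY t) (LX s) w \<longleftrightarrow> before (LY t) (LX s) z" for s t
    using Cons.prems(4)[of t s] dist by (auto simp: u cd sets dest: before_set)
  then show ?case using Cons.IH[of w] Cons.prems(1,2) sets by (simp add: u cd)
qed simp

lemma word_le_antisym:
  assumes "u \<in> Shuf m n" "v \<in> Shuf m n" "word_le u v" "word_le v u"
  shows "u = v"
proof (rule words_eqI)
  have "a \<in> set u \<longleftrightarrow> a \<in> set v" for a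
    using assms(3,4) by (cases a) (auto simp: word_le_def)
  then show "set u = set v" by blast
  show "before (LY t) (LX s) u \<longleftrightarrow> before (LY t) (LX s) v" for s t
    using assms(3,4) \<open>set u = set v\<close> before_set[of "LY t" "LX s"] unfolding word_le_def by blast
qed (use assms in \<open>auto simp: Shuf_iff\<close>)

lemma partial_order_Bub: "partial_order (Bub m n)"
  by (rule partial_orderI)
    (auto simp: Bub_def bubble_le_iff word_le_refl dest: word_le_antisym intro: word_le_trans)

section \<open>The code of a shuffle word\<close>

definition level :: "nat \<Rightarrow> word \<Rightarrow> nat \<Rightarrow> nat" where
  "level n u s = (if LX s \<in> set u then Max (insert 0 {t. before (LY t) (LX s) u}) else Suc n)"

definition code :: "nat \<Rightarrow> nat \<Rightarrow> word \<Rightarrow> nat set \<times> nat list" where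
  "code m n u = ({t. LY t \<in> set u}, map (level n u) [1..<Suc m])"

lemma finite_before: "finite {t. before (LY t) a u}"
proof (rule finite_subset)
  show "{t. before (LY t) a u} \<subseteq> LY -` set u" by (auto dest: before_set)
  show "finite (LY -` set u)" by (rule finite_vimageI) (auto simp: inj_on_def)
qed

lemma level_ge: "before (LY t) (LX s) u \<Longrightarrow> t \<le> level n u s"
  using finite_before[of "LX s" u] by (auto simp: level_def dest: before_set)

lemma level_before:
  assumes "LX s \<in> set u"
  shows "level n u s = 0 \<or> before (LY (level n u s)) (LX s) u"
  using Max_in[of "insert 0 {t. before (LY t) (LX s) u}"] finite_before[of "LX s" u] assms
  by (auto simp: level_def)

lemma level_le_iff:
  assumes "LX s \<in> set u"
  shows "level n u s \<le> k \<longleftrightarrow> (\<forall>t. before (LY t) (LX s) u \<longrightarrow> t \<le> k)"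
  using finite_before[of "LX s" u] assms by (auto simp: level_def)

lemma Shuf_Y_le: "u \<in> Shuf m n \<Longrightarrow> LY t \<in> set u \<Longrightarrow> 1 \<le> t \<and> t \<le> n"
  by (auto simp: Shuf_iff)

lemma level_le: "u \<in> Shuf m n \<Longrightarrow> LX s \<in> set u \<Longrightarrow> level n u s \<le> n"
  by (auto simp: level_le_iff dest!: before_set Shuf_Y_le)

lemma level_le_Suc: "u \<in> Shuf m n \<Longrightarrow> level n u s \<le> Suc n"
  using level_le[of u m n s] by (cases "LX s \<in> set u") (auto simp: level_def)

lemma before_Y_mono:
  assumes "sorted_wrt letters_ok u" "before (LY t') a u" "LY t \<in> set u" "t \<le> t'"
  shows "before (LY t) a u"
proof (cases "t = t'")
  case False
  have "\<not> before (LY t') (LY t) u"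
    using before_sorted_wrt[OF _ assms(1), of "LY t'" "LY t"] assms(4) by auto
  then have "before (LY t) (LY t') u"
    using before_total[of "LY t" u "LY t'"] assms False by (auto dest: before_set)
  then show ?thesis
    using assms(1,2) by (blast intro: before_trans[of _ "LY t'"] sorted_letters_ok_distinct)
qed (use assms in simp)

lemma code_le_iff:
  assumes u: "u \<in> Shuf m n" and v: "v \<in> Shuf m n"
  shows "code m n u \<sqsubseteq>\<^bsub>code_order A\<^esub> code m n v \<longleftrightarrow> word_le u v"
proof -
  have "code m n u \<sqsubseteq>\<^bsub>code_order A\<^esub> code m n v \<longleftrightarrow>
      (\<forall>t. LY t \<in> set u \<longrightarrow> LY t \<in> set v) \<and> (\<forall>s\<in>{1..m}. level n u s \<le> level n v s)"
    by (auto simp: code_def list_all2_map1 list_all2_map2 list_all2_same)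
  also have "\<dots> \<longleftrightarrow> word_le u v"
  proof safe
    assume Y: "\<forall>t. LY t \<in> set u \<longrightarrow> LY t \<in> set v" and le: "\<forall>s\<in>{1..m}. level n u s \<le> level n v s"
    show "word_le u v"
      unfolding word_le_def
    proof (intro conjI allI impI)
      fix s assume s: "LX s \<in> set v"
      then have "s \<in> {1..m}" using v by (auto simp: Shuf_iff)
      then have "level n u s \<le> n" using le level_le[OF v s] by fastforce
      then show "LX s \<in> set u" by (auto simp: level_def split: if_splits)
      fix t assume t: "before (LY t) (LX s) u"
      have "t \<le> level n v s" using level_ge[OF t] le \<open>s \<in> {1..m}\<close> order_trans by blast
      moreover have "1 \<le> t" "LY t \<in> set v"
        using Y before_set[OF t] Shuf_Y_le[OF u] by auto
      ultimately show "before (LY t) (LX s) v"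
        using level_before[OF s, of n] before_Y_mono[of v "level n v s" "LX s" t] v
        by (auto simp: Shuf_iff)
    qed (use Y in blast)
  next
    fix s assume le: "word_le u v"
    show "level n u s \<le> level n v s"
    proof (cases "LX s \<in> set v")
      case True
      then have "LX s \<in> set u" using le by (auto simp: word_le_def)
      then show ?thesis
        using True le by (auto simp: level_le_iff word_le_def intro: level_ge)
    next
      case False
      then show ?thesis using level_le_Suc[OF u] by (simp add: level_def)
    qed
  qed (auto simp: word_le_def)
  finally show ?thesis .
qed

lemma admissible_map:
  assumes "sorted_wrt (<) ss"
    "\<And>s. s \<in> set ss \<Longrightarrow> f s = Suc n \<or> f s \<in> insert 0 B \<and> (\<forall>s'\<in>set ss. s < s' \<longrightarrow> f s \<le> f s')"
  shows "admissible n B (map f ss)"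
  using assms
proof (induction ss)
  case (Cons s ss)
  have "admissible n B (map f ss)"
    using Cons.prems by (intro Cons.IH) fastforce+
  moreover have "f s = Suc n \<or> f s \<in> insert 0 B \<and> (\<forall>s'\<in>set ss. f s \<le> f s')"
    using Cons.prems(1) Cons.prems(2)[of s] by auto
  ultimately show ?case by simp
qed simp

lemma code_in_Codes:
  assumes u: "u \<in> Shuf m n"
  shows "code m n u \<in> Codes n m"
proof -
  have "admissible n {t. LY t \<in> set u} (map (level n u) [1..<Suc m])"
  proof (rule admissible_map)
    fix s assume "s \<in> set [1..<Suc m]"
    show "level n u s = Suc n \<or> level n u s \<in> insert 0 {t. LY t \<in> set u} \<and>
        (\<forall>s'\<in>set [1..<Suc m]. s < s' \<longrightarrow> level n u s \<le> level n u s')"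
    proof (cases "LX s \<in> set u")
      case s: True
      have "level n u s \<le> level n u s'" if "s < s'" for s'
      proof (cases "LX s' \<in> set u")
        case True
        have "\<not> before (LX s') (LX s) u"
          using before_sorted_wrt[of "LX s'" "LX s" u letters_ok] u that by (auto simp: Shuf_iff)
        then have "before (LX s) (LX s') u" using before_total[OF s True] that by auto
        then show ?thesis
          using s Shuf_distinct[OF u] by (auto simp: level_le_iff intro!: level_ge elim: before_trans)
      next
        case False
        then show ?thesis using level_le_Suc[OF u] by (simp add: level_def)
      qed
      moreover have "level n u s \<in> insert 0 {t. LY t \<in> set u}"
        using level_before[OF s, of n] by (auto dest: before_set)
      ultimately show ?thesis by blast
    qed (simp add: level_def)
  qed (simp del: upt_Suc)
  then show ?thesis using u by (auto simp: code_def Codes_def dest!: Shuf_Y_le)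
qed

lemma word_of_code:
  assumes "admissible n B cs" "B \<subseteq> {1..n}" "1 \<le> k" "k + length cs = Suc m"
  shows "\<exists>u. set u \<subseteq> LX ` {k..m} \<union> LY ` {1..n} \<and> sorted_wrt letters_ok u \<and>
    {t. LY t \<in> set u} = B \<and> map (level n u) [k..<Suc m] = cs"
  using assms
proof (induction cs arbitrary: k)
  case Nil
  define u where "u = map LY (sorted_list_of_set B)"
  have fin: "finite B" using Nil.prems(2) by (rule finite_subset) simp
  then have "set u = LY ` B" by (simp add: u_def)
  moreover have "sorted_wrt letters_ok u" by (simp add: u_def sorted_wrt_map)
  ultimately show ?case using Nil.prems by (intro exI[of _ u]) auto
next
  case (Cons c cs)
  obtain w where w: "set w \<subseteq> LX ` {Suc k..m} \<union> LY ` {1..n}" "sorted_wrt letters_ok w"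
    "{t. LY t \<in> set w} = B" "map (level n w) [Suc k..<Suc m] = cs"
    using Cons.IH[of "Suc k"] Cons.prems by auto
  have upt: "[k..<Suc m] = k # [Suc k..<Suc m]"
    using Cons.prems(4) by (intro upt_conv_Cons) auto
  have wk: "LX k \<notin> set w" using w(1) by auto
  have dist: "distinct w" using w(2) by (rule sorted_letters_ok_distinct)
  have "k \<le> m" using Cons.prems(4) by simp
  have insert: ?case
    if pq: "w = p @ q" and p: "\<And>s. LX s \<notin> set p" and c: "Max (insert 0 {t. LY t \<in> set p}) = c" for p q
  proof (intro exI conjI)
    let ?u = "p @ LX k # q"
    show "set ?u \<subseteq> LX ` {k..m} \<union> LY ` {1..n}" using w(1) \<open>k \<le> m\<close> by (auto simp: pq)
    have "letters_ok a (LX k)" if "a \<in> set p" for a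
      by (cases a) (use that p in auto)
    moreover have "letters_ok (LX k) a" if "a \<in> set q" for a
      by (cases a) (use that w(1) in \<open>auto simp: pq\<close>)
    ultimately show "sorted_wrt letters_ok ?u" using w(2) by (auto simp: pq sorted_wrt_append)
    show "{t. LY t \<in> set ?u} = B" using w(3) by (auto simp: pq)
    have "before (LY t) (LX k) ?u \<longleftrightarrow> LY t \<in> set p" for t
      using wk by (auto simp: pq before_append dest: before_set)
    then have "level n ?u k = c" using c by (simp add: level_def)
    moreover have "level n ?u s = level n w s" if "s \<noteq> k" for s
      using that by (simp add: level_def pq before_append)
    ultimately show "map (level n ?u) [k..<Suc m] = c # cs"
      unfolding upt w(4)[symmetric] by auto
  qed
  consider "c = Suc n" | "c = 0" | "c \<in> B" "\<forall>e\<in>set cs. c \<le> e"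
    using Cons.prems(1) by auto
  then show ?case
  proof cases
    case 1
    then have "map (level n w) [k..<Suc m] = c # cs"
      unfolding upt using w(4) wk by (simp add: level_def)
    then show ?thesis using w by (intro exI[of _ w]) force
  next
    case 2
    then show ?thesis by (intro insert[of "[]" w]) auto
  next
    case 3
    then have "LY c \<in> set w" using w(3) by auto
    then obtain p q where pq: "w = p @ LY c # q" by (auto dest: split_list)
    have "1 \<le> c" using 3 Cons.prems(2) by auto
    have "LX s \<notin> set p" for s
    proof
      assume s: "LX s \<in> set p"
      then have "s \<in> set [Suc k..<Suc m]" using w(1) by (auto simp: pq)
      then have "c \<le> level n w s" using 3 w(4) by auto
      moreover have "LX s \<in> set w" using s by (simp add: pq)
      ultimately have "before (LY (level n w s)) (LX s) w"
        using level_before[of s w n] \<open>1 \<le> c\<close> by auto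
      then have "before (LY c) (LX s) w"
        using before_Y_mono[OF w(2)] \<open>c \<le> level n w s\<close> by (simp add: pq)
      moreover have "before (LX s) (LY c) w" using s by (simp add: pq before_append)
      ultimately show False using dist by (auto dest: before_antisym)
    qed
    moreover have "Max (insert 0 {t. LY t \<in> set (p @ [LY c])}) = c"
    proof (rule Max_eqI)
      show "finite (insert 0 {t. LY t \<in> set (p @ [LY c])})"
        by (rule finite_subset[of _ "insert 0 B"])
          (use w(3) Cons.prems(2) in \<open>auto simp: pq intro: finite_subset\<close>)
      show "t \<le> c" if "t \<in> insert 0 {t. LY t \<in> set (p @ [LY c])}" for t
        using that w(2) by (auto simp: pq sorted_wrt_append)
    qed simp
    ultimately show ?thesis using insert[of "p @ [LY c]" q] by (simp add: pq)
  qed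
qed

lemma order_iso_code: "order_iso (Bub m n) (code_order (Codes n m)) (code m n)"
proof (intro order_iso.intro partial_order_Bub partial_order_code_order order_iso_axioms.intro)
  show mono: "code m n u \<sqsubseteq>\<^bsub>code_order (Codes n m)\<^esub> code m n v \<longleftrightarrow> u \<sqsubseteq>\<^bsub>Bub m n\<^esub> v"
    if "u \<in> carrier (Bub m n)" "v \<in> carrier (Bub m n)" for u v
    using that by (simp add: Bub_def code_le_iff bubble_le_iff)
  show "bij_betw (code m n) (carrier (Bub m n)) (carrier (code_order (Codes n m)))"
    unfolding bij_betw_def
  proof
    show "inj_on (code m n) (carrier (Bub m n))"
    proof (rule inj_onI)
      fix u v assume uv: "u \<in> carrier (Bub m n)" "v \<in> carrier (Bub m n)" "code m n u = code m n v"
      then have "u \<in> Shuf m n" "v \<in> Shuf m n" by (simp_all add: Bub_def)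
      moreover from this have "word_le u v" "word_le v u"
        using uv(3) code_le_iff[of _ m n _ UNIV] word_le_refl by metis+
      ultimately show "u = v" by (rule word_le_antisym)
    qed
    show "code m n ` carrier (Bub m n) = carrier (code_order (Codes n m))"
    proof (intro equalityI subsetI)
      fix x assume "x \<in> carrier (code_order (Codes n m))"
      then obtain B cs where x: "x = (B, cs)" "B \<subseteq> {1..n}" "length cs = m" "admissible n B cs"
        by (auto simp: Codes_def)
      then obtain u where "set u \<subseteq> LX ` {1..m} \<union> LY ` {1..n}" "sorted_wrt letters_ok u"
        "{t. LY t \<in> set u} = B" "map (level n u) [1..<Suc m] = cs"
        using word_of_code[of n B cs 1 m] by auto
      then have "u \<in> Shuf m n" "code m n u = x" by (auto simp: Shuf_iff code_def x)
      then show "x \<in> code m n ` carrier (Bub m n)" by (auto simp: Bub_def)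
    qed (auto simp: Bub_def code_in_Codes)
  qed
qed

theorem theorem1p1:
  fixes m n :: nat
  shows "lattice (Bub m n) \<and> extremal (Bub m n) \<and> semidistributive (Bub m n) \<and>
    constructable_by_interval_doublings (Bub m n)"
proof -
  interpret order_iso "Bub m n" "code_order (Codes n m)" "code m n"
    by (rule order_iso_code)
  have D: "doubling_lattice (n + m * Suc n) (Bub m n)"
    using doubling_lattice_Codes order_isomorphic_sym[OF isomorphic] partial_order_Bub
    by (rule doubling_lattice_isomorphic)
  moreover have "poset_length (Bub m n) = n + m * Suc n"
    using poset_length_eq poset_length_Codes by simp
  ultimately show ?thesis
    using doubling_latticeD[OF D] by (simp add: doubling_lattice_def extremal_def)
qed

end
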